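(* Let $B,C>0$. There is a positive number $A_0=A_0(B,C)$ such that for any $A\in[0,A_0]$ and any $z_0\in\mathbb{R}$ there is a smooth solution $(x,y,z)(t)$, $t\in\mathbb{R}$, of the ABC flow system $$x' = A\sin z + C\cos y,\qquad y' = B\sin x + A\cos z,\qquad z' = C\sin y + B\cos x,$$ with $z(0)=z_0$, such that $z$ is increasing in $t$, the limit $\lim_{t\to\infty} z(t)/t$ exists, this limit converges to $B+C$ as $A\to 0$, and $(x,y)$ is $2\pi$-periodic in $z$. Thus the solution is a ballistic spiral orbit moving helically in the direction of the $z$ axis.
   Context: Here $'$ denotes $d/dt$, and $A,B,C$ are real parameters of the ABC flow. The solution depends on $A$ and $z_0$ ($B,C$ being fixed); the convergence to $B+C$ as $A\to 0$ refers to the limits $\lim_{t\to\infty}z(t)/t$ for this family of solutions. "$(x,y)$ is $2\pi$-periodic in $z$" means that along the orbit, with $z$ used as the independent variable, there are $2\pi$-periodic functions $\xi,\eta:\mathbb{R}\to\mathbb{R}$ with $x(t)=\xi(z(t))$ and $y(t)=\eta(z(t))$ for all $t$. A spiral orbit is one in which $(x,y)$ stays within a single cell (a region enclosed by a heteroclinic cycle of the integrable flow with $A=0$) while $z$ grows monotonically; it is ballistic if $z$ grows linearly as $t\to\infty$. *)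

theory Defs
  imports "HOL-Analysis.Analysis"
begin

definition smooth :: "(real \<Rightarrow> real) \<Rightarrow> bool" where
  "smooth f \<longleftrightarrow> (\<forall>n t. (deriv ^^ n) f differentiable (at t))"

definition abc_solution ::
  "real \<Rightarrow> real \<Rightarrow> real \<Rightarrow> (real \<Rightarrow> real) \<Rightarrow> (real \<Rightarrow> real) \<Rightarrow> (real \<Rightarrow> real) \<Rightarrow> bool" where
  "abc_solution A B C x y z \<longleftrightarrow> (\<forall>t.
     (x has_real_derivative (A * sin (z t) + C * cos (y t))) (at t) \<and>
     (y has_real_derivative (B * sin (x t) + A * cos (z t))) (at t) \<and>
     (z has_real_derivative (C * sin (y t) + B * cos (x t))) (at t))"

text \<open>
  For \<open>A = 0\<close> the equations for \<open>(x, y)\<close> decouple from \<open>z\<close>; heteroclinic orbits and cells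
  refer to this planar flow, taken on the plane rather than on the torus.
\<close>

definition planar_field :: "real \<Rightarrow> real \<Rightarrow> real \<times> real \<Rightarrow> real \<times> real" where
  "planar_field B C p = (C * cos (snd p), B * sin (fst p))"

definition heteroclinic_orbit ::
  "real \<Rightarrow> real \<Rightarrow> real \<times> real \<Rightarrow> real \<times> real \<Rightarrow> (real \<Rightarrow> real \<times> real) \<Rightarrow> bool" where
  "heteroclinic_orbit B C p q \<gamma> \<longleftrightarrow>
     p \<noteq> q \<and> planar_field B C p = 0 \<and> planar_field B C q = 0 \<and>
     (\<forall>t. (\<gamma> has_vector_derivative planar_field B C (\<gamma> t)) (at t)) \<and>
     (\<gamma> \<longlongrightarrow> p) at_bot \<and> (\<gamma> \<longlongrightarrow> q) at_top"

text \<open>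
  A heteroclinic cycle consists of cyclically connected heteroclinic orbits together with the
  equilibria they connect. The equilibria are distinct, so that it is a simple closed curve.
\<close>

definition heteroclinic_cycle :: "real \<Rightarrow> real \<Rightarrow> (real \<times> real) set \<Rightarrow> bool" where
  "heteroclinic_cycle B C \<Gamma> \<longleftrightarrow> (\<exists>n p \<gamma>. 2 \<le> n \<and> inj_on p {..<n} \<and>
     (\<forall>i<n. heteroclinic_orbit B C (p i) (p (Suc i mod n)) (\<gamma> i)) \<and>
     \<Gamma> = p ` {..<n} \<union> (\<Union>i<n. range (\<gamma> i)))"

text \<open>
  The last conjunct says that a cell is not subdivided by further separatrices. For \<open>B = C\<close> the
  separatrices form a square grid, in which there are also heteroclinic cycles around several
  adjacent squares (for example a plus of five squares); those regions are not single cells.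
\<close>

definition cell :: "real \<Rightarrow> real \<Rightarrow> (real \<times> real) set \<Rightarrow> bool" where
  "cell B C U \<longleftrightarrow> (\<exists>\<Gamma>. heteroclinic_cycle B C \<Gamma> \<and> U = inside \<Gamma>) \<and>
     (\<forall>p q \<gamma>. heteroclinic_orbit B C p q \<gamma> \<longrightarrow> range \<gamma> \<inter> U = {})"

definition spiral_orbit ::
  "real \<Rightarrow> real \<Rightarrow> (real \<Rightarrow> real) \<Rightarrow> (real \<Rightarrow> real) \<Rightarrow> (real \<Rightarrow> real) \<Rightarrow> bool" where
  "spiral_orbit B C x y z \<longleftrightarrow>
     (\<exists>U. cell B C U \<and> (\<forall>t. (x t, y t) \<in> U)) \<and> strict_mono z"

definition ballistic :: "(real \<Rightarrow> real) \<Rightarrow> bool" where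
  "ballistic z \<longleftrightarrow> (\<exists>v>0. ((\<lambda>t. z t / t) \<longlongrightarrow> v) at_top)"

text \<open>Periodicity of \<open>f\<close> as a function of the new independent variable \<open>z\<close>.\<close>

definition periodic_in :: "(real \<Rightarrow> real) \<Rightarrow> (real \<Rightarrow> real) \<Rightarrow> bool" where
  "periodic_in z f \<longleftrightarrow> (\<exists>\<xi>. (\<forall>s. \<xi> (s + 2 * pi) = \<xi> s) \<and> (\<forall>t. f t = \<xi> (z t)))"

end

theory Submission
  imports Defs "HOL-Library.Periodic_Fun"
begin

text \<open>
  For \<open>A = 0\<close> the point \<open>(0, \<pi>/2)\<close> is a centre of the planar flow, at which \<open>z' = B + C\<close>. With \<open>z\<close> as
  the independent variable, its linear frequency \<open>\<omega> = \<surd>(B C) / (B + C)\<close> is at most \<open>1/2\<close>, whereas the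
  forcing is \<open>2\<pi>\<close>-periodic in \<open>z\<close>. The forcing is therefore nonresonant, and the contraction
  principle, applied to the variation of constants formula, gives for small \<open>A\<close> a \<open>2\<pi>\<close>-periodic solution
  \<open>(x, y)(z)\<close> at distance \<open>O(A)\<close> from the centre. Solving the scalar periodic equation for \<open>z(t)\<close> yields
  the ballistic orbit, whose mean speed differs from \<open>B + C\<close> by \<open>O(A)\<close>. The cell around the centre is
  the part of the square of side \<open>2\<pi>\<close> on which the first integral \<open>B cos x + C sin y\<close> exceeds its
  saddle value \<open>\<bar>B - C\<bar>\<close>; the separatrices bounding it are explicit.
\<close>

section \<open>The cell around the centre\<close>

text \<open>Taking \<open>z\<close> as the independent variable removes the direction in which
  orbits drift: a helical orbit becomes a periodic solution of a planar system, and
  \<open>z0\<close> merely fixes the starting phase, so that all bounds are uniform in it.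
  Nonresonance enters because the solution must return after one period. The linear flow over a
  period is a rotation by \<open>2 * pi * \<omega>\<close>; its difference from the identity has to
  be inverted, which fails only for integer \<omega>. The bound 1/2 is the inequality between
  geometric and arithmetic mean of \<open>B\<close> and \<open>C\<close>. The contraction rests on
  smallness of order \<open>r\<close> of the Lipschitz constant of the nonlinear remainder on a ball
  of radius \<open>r\<close> about the centre. Hence \<open>r\<close> is fixed first and the range
  of \<open>A\<close> afterwards, so that an orbit of size proportional to \<open>A\<close> fits
  into the ball. A cell is defined through orbits that tend to equilibria, so knowing the level
  curve as a set is not enough: its arcs are parametrised by time. Their combinatorics jump at
  \<open>B = C\<close>: four saddles lie on the boundary of the cell then, two otherwise.\<close>

definition energy :: "real \<Rightarrow> real \<Rightarrow> real \<times> real \<Rightarrow> real" where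
  "energy B C p = B * cos (fst p) + C * sin (snd p)"

definition cell_region :: "real \<Rightarrow> real \<Rightarrow> (real \<times> real) set" where
  "cell_region B C =
     {p. \<bar>fst p\<bar> < pi \<and> \<bar>snd p - pi / 2\<bar> < pi \<and> \<bar>B - C\<bar> < energy B C p}"

definition cell_boundary :: "real \<Rightarrow> real \<Rightarrow> (real \<times> real) set" where
  "cell_boundary B C =
     {p. \<bar>fst p\<bar> \<le> pi \<and> \<bar>snd p - pi / 2\<bar> \<le> pi \<and> energy B C p = \<bar>B - C\<bar>}"

lemma energy_alt: "energy B C p = B * cos (fst p) + C * cos (snd p - pi / 2)"
  by (simp add: energy_def cos_diff)

lemma cos_abs_mono:
  fixes u v :: real
  assumes "\<bar>u\<bar> \<le> \<bar>v\<bar>" "\<bar>v\<bar> \<le> pi"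
  shows "cos v \<le> cos u"
  using cos_monotone_0_pi_le[of "\<bar>u\<bar>" "\<bar>v\<bar>"] assms by simp

lemma cos_abs_inj:
  fixes u v :: real
  assumes "cos u = cos v" "\<bar>u\<bar> \<le> pi" "\<bar>v\<bar> \<le> pi"
  shows "\<bar>u\<bar> = \<bar>v\<bar>"
  using cos_inj_pi[of "\<bar>u\<bar>" "\<bar>v\<bar>"] assms by simp

lemma open_cell_region: "open (cell_region B C)"
  unfolding cell_region_def energy_def
  by (intro open_Collect_conj open_Collect_less continuous_intros)

section \<open>The region enclosed by the saddle level\<close>

text \<open>The closed region \<open>K\<close> is star-shaped about the centre, because the cosine
  decreases with the absolute value of its argument on \<open>[-pi, pi]\<close>. A point outside
  \<open>K\<close> therefore escapes to infinity along a ray without meeting the boundary curve. A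
  point of the open region is trapped, since the frontier of that bounded region consists of
  boundary points.\<close>

lemma inside_cell_boundary:
  assumes "B > 0" "C > 0"
  shows "inside (cell_boundary B C) = cell_region B C"
proof -
  define c :: "real \<times> real" where "c = (0, pi / 2)"
  define K where "K = {p. \<bar>fst p\<bar> \<le> pi \<and> \<bar>snd p - pi / 2\<bar> \<le> pi \<and> \<bar>B - C\<bar> \<le> energy B C p}"
  let ?R = "cell_region B C" and ?G = "cell_boundary B C"
  have clK: "closed K"
    unfolding K_def energy_def
    by (intro closed_Collect_conj closed_Collect_le continuous_intros)
  have RK: "?R \<subseteq> K" and GK: "?G \<subseteq> K"
    by (auto simp: K_def cell_region_def cell_boundary_def)
  \<comment> \<open>On a side of the square one of the two cosines is -1, so the energy is at most
    \<open>\<bar>B - C\<bar>\<close> there; points of \<open>K\<close> on a side are thus on the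
    saddle level.\<close>
  have KRG: "K - ?R \<subseteq> ?G"
  proof
    fix p assume p: "p \<in> K - ?R"
    have 1: "energy B C p \<le> \<bar>B - C\<bar>" if "\<bar>fst p\<bar> = pi"
    proof -
      have "cos (fst p) = - 1" using that by (metis cos_abs_real cos_pi)
      moreover have "C * cos (snd p - pi / 2) \<le> C * 1"
        using assms by (intro mult_left_mono) auto
      ultimately show ?thesis by (simp add: energy_alt)
    qed
    have 2: "energy B C p \<le> \<bar>B - C\<bar>" if "\<bar>snd p - pi / 2\<bar> = pi"
    proof -
      have "cos (snd p - pi / 2) = - 1" using that by (metis cos_abs_real cos_pi)
      moreover have "B * cos (fst p) \<le> B * 1"
        using assms by (intro mult_left_mono) auto
      ultimately show ?thesis unfolding energy_alt by simp
    qed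
    show "p \<in> ?G" using p 1 2 by (force simp: K_def cell_region_def cell_boundary_def)
  qed
  have frR: "frontier ?R \<subseteq> ?G"
    using closure_minimal[OF RK clK] KRG open_cell_region[of B C]
    by (auto simp: frontier_def interior_open)
  have "bounded ?R"
  proof (rule bounded_subset[OF bounded_cbox])
    show "?R \<subseteq> cbox (-pi, -pi/2) (pi, 3*pi/2)"
      by (auto simp: cell_region_def cbox_Pair_eq abs_less_iff algebra_simps)
  qed
  \<comment> \<open>Used in the contrapositive: moving outwards from a point outside
    \<open>K\<close> never enters \<open>K\<close>.\<close>
  have star: "p \<in> K" if s: "s \<ge> 1" and ps: "c + s *\<^sub>R (p - c) \<in> K" for p s
  proof -
    obtain X Y where p: "p = (X, pi / 2 + Y)"
      by (metis add_diff_cancel_left' diff_add_cancel prod.exhaust add.commute)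
    have "\<bar>s * X\<bar> \<le> pi" "\<bar>s * Y\<bar> \<le> pi" "\<bar>B - C\<bar> \<le> B * cos (s * X) + C * cos (s * Y)"
      using ps by (auto simp: K_def c_def p energy_alt)
    moreover have "\<bar>X\<bar> \<le> \<bar>s * X\<bar>" "\<bar>Y\<bar> \<le> \<bar>s * Y\<bar>"
      using s by (auto simp: abs_mult intro: mult_le_cancel_right1[THEN iffD2])
    moreover from calculation have "B * cos (s * X) \<le> B * cos X" "C * cos (s * Y) \<le> C * cos Y"
      using assms by (auto intro!: mult_left_mono cos_abs_mono)
    ultimately show ?thesis by (auto simp: K_def p energy_alt)
  qed
  have cK: "c \<in> K"
    using assms by (auto simp: K_def c_def energy_def)
  show ?thesis
  proof (intro equalityI subsetI)
    fix p assume p: "p \<in> ?R"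
    let ?Q = "connected_component_set (- ?G) p"
    have pG: "p \<notin> ?G" using p by (auto simp: cell_region_def cell_boundary_def)
    have "?Q \<subseteq> ?R"
    proof (rule ccontr)
      assume "\<not> ?Q \<subseteq> ?R"
      then have "?Q \<inter> frontier ?R \<noteq> {}"
        using p pG connected_component_refl[of p "- ?G"]
        by (intro connected_Int_frontier connected_connected_component) blast+
      moreover have "?Q \<subseteq> - ?G" by (rule connected_component_subset)
      ultimately show False using frR by blast
    qed
    then show "p \<in> inside ?G"
      using pG bounded_subset[OF \<open>bounded ?R\<close>] by (auto simp: inside_def)
  next
    fix p assume p: "p \<in> inside ?G"
    show "p \<in> ?R"
    proof (rule ccontr)
      assume "p \<notin> ?R"
      then have pK: "p \<notin> K" using KRG p by (auto simp: inside_def)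
      let ?L = "(\<lambda>s. c + s *\<^sub>R (p - c)) ` {1..}"
      have "connected ?L"
        by (intro connected_continuous_image continuous_intros) auto
      moreover have "?L \<subseteq> - ?G" using star[where p = p] pK GK by blast
      moreover have "p \<in> ?L" by (rule image_eqI[where x = 1]) auto
      ultimately have "?L \<subseteq> connected_component_set (- ?G) p"
        by (intro connected_component_maximal)
      then have "bounded ?L" using p bounded_subset by (auto simp: inside_def)
      then obtain M where M: "\<And>s. s \<ge> 1 \<Longrightarrow> norm (c + s *\<^sub>R (p - c)) \<le> M"
        by (auto simp: bounded_iff)
      have pc: "norm (p - c) > 0" using pK cK by auto
      define s where "s = max 1 ((M + norm c + 1) / norm (p - c))"
      have "M + norm c + 1 \<le> s * norm (p - c)"
        using pc by (simp add: s_def pos_divide_le_eq[symmetric])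
      also have "\<dots> = norm (s *\<^sub>R (p - c))" by (simp add: s_def)
      also have "\<dots> \<le> norm (c + s *\<^sub>R (p - c)) + norm c"
        by (metis add.commute add_diff_cancel_left' norm_triangle_ineq4)
      also have "\<dots> \<le> M + norm c" using M[of s] by (simp add: s_def)
      finally show False by simp
    qed
  qed
qed

section \<open>Heteroclinic orbits avoid the region\<close>

text \<open>The energy is a first integral of the planar flow, and continuity identifies its
  constant value with the limit at time minus infinity.\<close>

lemma heteroclinic_energy:
  assumes "heteroclinic_orbit B C p q \<gamma>"
  shows "energy B C (\<gamma> t) = energy B C p"
proof -
  have d: "(\<gamma> has_vector_derivative planar_field B C (\<gamma> t)) (at t)" for t
    using assms by (auto simp: heteroclinic_orbit_def)
  have d1: "((\<lambda>t. fst (\<gamma> t)) has_real_derivative C * cos (snd (\<gamma> t))) (at t)" for t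
    using bounded_linear.has_vector_derivative[OF bounded_linear_fst d[of t]]
    by (simp add: planar_field_def has_real_derivative_iff_has_vector_derivative)
  have d2: "((\<lambda>t. snd (\<gamma> t)) has_real_derivative B * sin (fst (\<gamma> t))) (at t)" for t
    using bounded_linear.has_vector_derivative[OF bounded_linear_snd d[of t]]
    by (simp add: planar_field_def has_real_derivative_iff_has_vector_derivative)
  have "((\<lambda>t. energy B C (\<gamma> t)) has_real_derivative 0) (at t)" for t
    unfolding energy_def
    by (auto intro!: derivative_eq_intros d1 d2)
  then have const: "(\<lambda>s. energy B C (\<gamma> s)) = (\<lambda>s. energy B C (\<gamma> t))"
    using DERIV_isconst_all[of "\<lambda>s. energy B C (\<gamma> s)"] by blast
  have "((\<lambda>s. energy B C (\<gamma> s)) \<longlongrightarrow> energy B C p) at_bot"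
    unfolding energy_def
    using assms by (auto intro!: tendsto_intros simp: heteroclinic_orbit_def)
  then show ?thesis
    unfolding const by (simp add: tendsto_const_iff)
qed

text \<open>The energies of equilibria are the four values of B and C combined with signs, and only
  \<open>B + C\<close> exceeds \<open>\<bar>B - C\<bar>\<close>. This is the global maximum of the
  energy, attained at equilibria alone, so an orbit on that level is constant and cannot connect two
  different points.\<close>

lemma heteroclinic_not_in_cell_region:
  assumes "B > 0" "C > 0" and het: "heteroclinic_orbit B C p q \<gamma>"
  shows "range \<gamma> \<inter> cell_region B C = {}"
proof (rule ccontr)
  assume "range \<gamma> \<inter> cell_region B C \<noteq> {}"
  then obtain t where "\<bar>B - C\<bar> < energy B C (\<gamma> t)" by (auto simp: cell_region_def)
  then have e: "\<bar>B - C\<bar> < energy B C p" using heteroclinic_energy[OF het] by simp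
  have "cos (snd p) = 0" "sin (fst p) = 0"
    using het assms by (auto simp: heteroclinic_orbit_def planar_field_def zero_prod_def)
  then have "\<bar>sin (snd p)\<bar> = 1" "\<bar>cos (fst p)\<bar> = 1"
    using sin_zero_abs_cos_one[of "snd p - pi / 2"] sin_zero_abs_cos_one[of "fst p"]
    by (simp_all add: cos_diff sin_diff)
  then have "sin (snd p) = 1 \<or> sin (snd p) = -1" "cos (fst p) = 1 \<or> cos (fst p) = -1"
    by linarith+
  then have "energy B C p = B + C" using e assms by (auto simp: energy_def)
  then have E: "B * cos (fst (\<gamma> s)) + C * sin (snd (\<gamma> s)) = B + C" for s
    using heteroclinic_energy[OF het, of s] by (simp add: energy_def)
  have "planar_field B C (\<gamma> s) = 0" for s
  proof -
    have "B * cos (fst (\<gamma> s)) \<le> B * 1" "C * sin (snd (\<gamma> s)) \<le> C * 1"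
      using assms by (intro mult_left_mono; simp)+
    then have "B * cos (fst (\<gamma> s)) = B" "C * sin (snd (\<gamma> s)) = C" using E[of s] by linarith+
    then have "cos (fst (\<gamma> s)) = 1" "sin (snd (\<gamma> s)) = 1" using assms by auto
    then have "sin (fst (\<gamma> s)) = 0" "cos (snd (\<gamma> s)) = 0"
      using cos_one_sin_zero[of "fst (\<gamma> s)"] cos_one_sin_zero[of "snd (\<gamma> s) - pi / 2"]
      by (simp_all add: cos_diff sin_diff)
    then show ?thesis by (simp add: planar_field_def zero_prod_def)
  qed
  then have "(\<gamma> has_vector_derivative 0) (at s within UNIV)" for s
    using het by (metis heteroclinic_orbit_def)
  then obtain c where "\<And>s. \<gamma> s = c"
    using has_vector_derivative_zero_constant[of UNIV \<gamma>] by auto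
  then have "\<gamma> = (\<lambda>s. c)" by auto
  then have "((\<lambda>s::real. c) \<longlongrightarrow> p) at_bot" "((\<lambda>s::real. c) \<longlongrightarrow> q) at_top" "p \<noteq> q"
    using het by (auto simp: heteroclinic_orbit_def)
  then show False by (auto simp: tendsto_const_iff)
qed

section \<open>Explicit separatrices\<close>

lemma sin_double_arctan: "sin (2 * arctan w) = 2 * w / (1 + w\<^sup>2)"
proof -
  have "0 < 1 + w\<^sup>2" by (simp add: add_pos_nonneg)
  then show ?thesis
    by (simp add: sin_double sin_arctan cos_arctan flip: power2_eq_square)
qed

lemma cos_double_arctan: "cos (2 * arctan w) = (1 - w\<^sup>2) / (1 + w\<^sup>2)"
proof -
  have "0 < 1 + w\<^sup>2" by (simp add: add_pos_nonneg)
  then show ?thesis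
    by (simp add: cos_double sin_arctan cos_arctan power_divide diff_divide_distrib)
qed

lemma abs_double_arctan_less: "\<bar>2 * arctan w\<bar> < pi"
  using arctan[of w] by (auto simp: abs_less_iff)

text \<open>
  The quarter turn about the centre \<open>(0, \<pi>/2)\<close> exchanges \<open>B\<close> and \<open>C\<close>, so that the case \<open>B > C\<close>
  reduces to \<open>B < C\<close>.
\<close>

definition quarter_turn :: "real \<times> real \<Rightarrow> real \<times> real" where
  "quarter_turn p = (pi / 2 - snd p, fst p + pi / 2)"

lemma inj_quarter_turn: "inj quarter_turn"
  by (auto simp: inj_def quarter_turn_def prod_eq_iff)

text \<open>The linear part of \<open>quarter_turn\<close> sends \<open>(u, v)\<close> to
  \<open>(- v, u)\<close>, so the identity says that the turn carries the flow with exchanged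
  parameters to the original one.\<close>

lemma planar_field_quarter_turn:
  "planar_field B C (quarter_turn p) = (- snd (planar_field C B p), fst (planar_field C B p))"
  by (simp add: planar_field_def quarter_turn_def sin_diff cos_add)

lemma heteroclinic_orbit_quarter_turn:
  assumes "heteroclinic_orbit C B p q \<gamma>"
  shows "heteroclinic_orbit B C (quarter_turn p) (quarter_turn q) (\<lambda>t. quarter_turn (\<gamma> t))"
proof -
  have lim: "((\<lambda>t. quarter_turn (\<gamma> t)) \<longlongrightarrow> quarter_turn l) F" if "(\<gamma> \<longlongrightarrow> l) F" for l F
    unfolding quarter_turn_def using that by (intro tendsto_intros)
  have der: "((\<lambda>t. quarter_turn (\<gamma> t)) has_vector_derivative planar_field B C (quarter_turn (\<gamma> t))) (at t)" for t
  proof -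
    have d: "(\<gamma> has_vector_derivative planar_field C B (\<gamma> t)) (at t)"
      using assms by (auto simp: heteroclinic_orbit_def)
    have "((\<lambda>t. quarter_turn (\<gamma> t)) has_vector_derivative
        (0 - snd (planar_field C B (\<gamma> t)), fst (planar_field C B (\<gamma> t)) + 0)) (at t)"
      unfolding quarter_turn_def
      by (intro has_vector_derivative_Pair has_vector_derivative_diff has_vector_derivative_add
          has_vector_derivative_const bounded_linear.has_vector_derivative[OF bounded_linear_fst d]
          bounded_linear.has_vector_derivative[OF bounded_linear_snd d])
    then show ?thesis by (simp add: planar_field_quarter_turn)
  qed
  have "quarter_turn p \<noteq> quarter_turn q" using assms inj_quarter_turn
    by (auto simp: heteroclinic_orbit_def dest: injD)
  moreover have "planar_field B C (quarter_turn p) = 0" "planar_field B C (quarter_turn q) = 0"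
    using assms by (auto simp: heteroclinic_orbit_def planar_field_quarter_turn zero_prod_def)
  ultimately show ?thesis
    using assms der lim by (auto simp: heteroclinic_orbit_def)
qed

lemma heteroclinic_cycle_quarter_turn:
  assumes "heteroclinic_cycle C B \<Gamma>"
  shows "heteroclinic_cycle B C (quarter_turn ` \<Gamma>)"
proof -
  obtain n p \<gamma> where n: "2 \<le> n" and inj: "inj_on p {..<n}"
    and het: "\<And>i. i < n \<Longrightarrow> heteroclinic_orbit C B (p i) (p (Suc i mod n)) (\<gamma> i)"
    and \<Gamma>: "\<Gamma> = p ` {..<n} \<union> (\<Union>i<n. range (\<gamma> i))"
    using assms by (auto simp: heteroclinic_cycle_def)
  show ?thesis
    unfolding heteroclinic_cycle_def
  proof (intro exI conjI allI impI)
    show "inj_on (quarter_turn \<circ> p) {..<n}"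
      by (intro comp_inj_on inj inj_on_subset[OF inj_quarter_turn]) auto
    show "heteroclinic_orbit B C ((quarter_turn \<circ> p) i) ((quarter_turn \<circ> p) (Suc i mod n)) ((\<lambda>i t. quarter_turn (\<gamma> i t)) i)"
      if "i < n" for i
      using heteroclinic_orbit_quarter_turn[OF het[OF that]] by simp
    show "quarter_turn ` \<Gamma> = (quarter_turn \<circ> p) ` {..<n} \<union> (\<Union>i<n. range ((\<lambda>i t. quarter_turn (\<gamma> i t)) i))"
      by (simp add: \<Gamma> image_Un image_UN image_image)
  qed (fact n)
qed

lemma quarter_turn_cell_boundary: "quarter_turn ` cell_boundary C B = cell_boundary B C"
proof (intro equalityI subsetI)
  fix p assume "p \<in> quarter_turn ` cell_boundary C B"
  then show "p \<in> cell_boundary B C"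
    by (auto simp: cell_boundary_def quarter_turn_def energy_alt sin_add sin_diff cos_diff abs_minus_commute)
next
  fix p assume p: "p \<in> cell_boundary B C"
  have "p = quarter_turn (snd p - pi / 2, pi / 2 - fst p)" by (simp add: quarter_turn_def)
  moreover have "(snd p - pi / 2, pi / 2 - fst p) \<in> cell_boundary C B"
    using p by (auto simp: cell_boundary_def energy_alt abs_minus_commute)
  ultimately show "p \<in> quarter_turn ` cell_boundary C B" by (rule image_eqI)
qed

text \<open>
  On the level \<open>C - B\<close> of the energy, with \<open>y = \<pi>/2 + Y\<close>, the separatrices are the curves
  \<open>sin (Y/2) = \<plusminus> k cos (x/2)\<close>. The substitution \<open>w = tan (x/2)\<close> turns the flow on this curve into
  \<open>w' = \<mp> l \<surd>(w\<^sup>2 + m\<^sup>2)\<close>, which is solved by a hyperbolic sine.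
\<close>

lemma heteroclinic_cycle_less:
  assumes "0 < B" "B < C"
  shows "heteroclinic_cycle B C (cell_boundary B C)"
proof -
  \<comment> \<open>Here \<open>l\<close> is the positive eigenvalue of the linearisation at the
    saddles, \<open>k\<close> the slope in the equation of the curve, and
    \<open>m\<^sup>2 = 1 - k\<^sup>2\<close>; \<open>B < C\<close> makes \<open>m\<close>
    positive.\<close>
  define k m l where "k = sqrt (B / C)" and "m = sqrt (1 - B / C)" and "l = sqrt (B * C)"
  have k: "k > 0" "k\<^sup>2 = B / C" and m: "m > 0" "m\<^sup>2 = 1 - B / C" and l: "l > 0"
    using assms by (auto simp: k_def m_def l_def)
  have Ck: "C * k = l" and kl: "k * l = B"
    using assms by (auto simp: k_def l_def real_sqrt_divide real_sqrt_mult field_simps)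
  define X where "X t = 2 * arctan (m * sinh (l * t))" for t
  define Y where "Y t = 2 * arctan (k / (m * cosh (l * t)))" for t
  \<comment> \<open>Reflection in the centre is a symmetry of the flow: \<open>s = 1\<close> is the
    upper arc, run from right to left, and \<open>s = - 1\<close> its reflection.\<close>
  define \<gamma> where "\<gamma> s t = (- s * X t, pi / 2 + s * Y t)" for s t
  define p :: "nat \<Rightarrow> real \<times> real" where "p i = (if i = 0 then (pi, pi / 2) else (- pi, pi / 2))" for i
  define \<sigma> :: "nat \<Rightarrow> real" where "\<sigma> i = (if i = 0 then 1 else - 1)" for i
  have pos: "1 + (m * sinh (l * t))\<^sup>2 > 0" for t by (simp add: add_pos_nonneg)
  have denom: "(m * cosh (l * t))\<^sup>2 + k\<^sup>2 = 1 + (m * sinh (l * t))\<^sup>2" for t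
    using cosh_square_eq[of "l * t"] k m by (simp add: power_mult_distrib algebra_simps)
  have mc: "m * cosh (l * t) > 0" for t using m by simp
  have Y1: "1 + (k / (m * cosh (l * t)))\<^sup>2 = (1 + (m * sinh (l * t))\<^sup>2) / (m * cosh (l * t))\<^sup>2" for t
    using mc[of t] m(1) unfolding denom[symmetric] power_divide add_divide_distrib by simp
  have sinX: "sin (X t) = 2 * m * sinh (l * t) / (1 + (m * sinh (l * t))\<^sup>2)" for t
    by (simp add: X_def sin_double_arctan)
  have sinY: "sin (Y t) = 2 * k * m * cosh (l * t) / (1 + (m * sinh (l * t))\<^sup>2)" for t
    unfolding Y_def sin_double_arctan Y1 using mc[of t] pos[of t] m(1)
    by (simp add: power2_eq_square)
  have cosX: "B * cos (X t) + C * cos (Y t) = C - B" for t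
  proof -
    have "cos (X t) = 2 / (1 + (m * sinh (l * t))\<^sup>2) - 1"
      using pos[of t] by (simp add: X_def cos_double_arctan field_simps)
    moreover have "cos (Y t) = 1 - 2 * k\<^sup>2 / (1 + (m * sinh (l * t))\<^sup>2)"
    proof -
      have "cos (Y t) = ((m * cosh (l * t))\<^sup>2 - k\<^sup>2) / (1 + (m * sinh (l * t))\<^sup>2)"
      proof -
        have "1 - (k / (m * cosh (l * t)))\<^sup>2 = ((m * cosh (l * t))\<^sup>2 - k\<^sup>2) / (m * cosh (l * t))\<^sup>2"
          unfolding power_divide diff_divide_distrib using mc[of t] m(1) by simp
        then show ?thesis
          unfolding Y_def cos_double_arctan Y1 using mc[of t] m(1) by simp
      qed
      then show ?thesis using pos[of t] denom[of t] by (simp add: field_simps)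
    qed
    moreover have "C * (2 * k\<^sup>2 / (1 + (m * sinh (l * t))\<^sup>2)) = B * (2 / (1 + (m * sinh (l * t))\<^sup>2))"
      using k assms by simp
    ultimately show ?thesis by (simp only: right_diff_distrib)
  qed
  have dX: "(X has_real_derivative C * sin (Y t)) (at t)" for t
    unfolding X_def
    by (rule derivative_eq_intros refl)+
      (simp add: sinY Ck[symmetric] field_simps)
  have dY: "(Y has_real_derivative - (B * sin (X t))) (at t)" for t
  proof -
    define u where "u = m * cosh (l * t)"
    have u: "u > 0" using mc by (simp add: u_def)
    have "(Y has_real_derivative
        2 * (inverse (1 + (k / u)\<^sup>2) * (- (k * (m * (l * sinh (l * t)))) / (u * u)))) (at t)"
      unfolding Y_def u_def using u
      by (auto intro!: derivative_eq_intros simp: u_def)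
    also have "1 + (k / u)\<^sup>2 = (1 + (m * sinh (l * t))\<^sup>2) / (u * u)"
      using Y1[of t] by (simp add: u_def power2_eq_square)
    finally show ?thesis
      using u by (simp add: sinX kl[symmetric] mult_ac)
  qed
  have limX: "(X \<longlongrightarrow> pi) at_top" "(X \<longlongrightarrow> - pi) at_bot"
  proof -
    have "filterlim (\<lambda>t. m * sinh (l * t)) at_top at_top"
      using l m by (intro filterlim_tendsto_pos_mult_at_top[OF tendsto_const] 
          filterlim_compose[OF sinh_real_at_top] filterlim_ident)
    from tendsto_mult_left[OF filterlim_compose[OF tendsto_arctan_at_top this], of 2]
    show "(X \<longlongrightarrow> pi) at_top" unfolding X_def by simp
    have "filterlim (\<lambda>t. m * sinh (l * t)) at_bot at_bot"
      using l m by (intro filterlim_tendsto_pos_mult_at_bot[OF tendsto_const] 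
          filterlim_compose[OF sinh_real_at_bot] filterlim_ident)
    from tendsto_mult_left[OF filterlim_compose[OF tendsto_arctan_at_bot this], of 2]
    show "(X \<longlongrightarrow> - pi) at_bot" unfolding X_def by simp
  qed
  have limY: "(Y \<longlongrightarrow> 0) at_top" "(Y \<longlongrightarrow> 0) at_bot"
  proof -
    have "filterlim (\<lambda>t. m * cosh (l * t)) at_top at_top"
      using l m by (intro filterlim_tendsto_pos_mult_at_top[OF tendsto_const] 
          filterlim_compose[OF cosh_real_at_top] filterlim_ident)
    then have "((\<lambda>t. k / (m * cosh (l * t))) \<longlongrightarrow> 0) at_top"
      by (intro tendsto_divide_0[OF tendsto_const] filterlim_at_top_imp_at_infinity)
    from tendsto_mult_left[OF tendsto_arctan[OF this], of 2]
    show "(Y \<longlongrightarrow> 0) at_top" unfolding Y_def by simp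
    have "filterlim (\<lambda>t. l * t) at_bot at_bot"
      using l by (intro filterlim_tendsto_pos_mult_at_bot[OF tendsto_const] filterlim_ident)
    then have "filterlim (\<lambda>t. m * cosh (l * t)) at_top at_bot"
      using m by (intro filterlim_tendsto_pos_mult_at_top[OF tendsto_const] 
          filterlim_compose[OF cosh_real_at_bot])
    then have "((\<lambda>t. k / (m * cosh (l * t))) \<longlongrightarrow> 0) at_bot"
      by (intro tendsto_divide_0[OF tendsto_const] filterlim_at_top_imp_at_infinity)
    from tendsto_mult_left[OF tendsto_arctan[OF this], of 2]
    show "(Y \<longlongrightarrow> 0) at_bot" unfolding Y_def by simp
  qed
  have het: "heteroclinic_orbit B C (s * pi, pi / 2) (- s * pi, pi / 2) (\<gamma> s)"
    if s: "s = 1 \<or> s = - 1" for s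
  proof -
    have "(\<gamma> s has_vector_derivative (- s * (C * sin (Y t)), s * (- B * sin (X t)))) (at t)" for t
      unfolding \<gamma>_def
      by (rule has_vector_derivative_Pair)
        (auto simp flip: has_real_derivative_iff_has_vector_derivative
          intro!: derivative_eq_intros dX dY)
    moreover have "(- s * (C * sin (Y t)), s * (- B * sin (X t))) = planar_field B C (\<gamma> s t)" for t
      using s by (auto simp: planar_field_def \<gamma>_def cos_add cos_diff sin_diff)
    ultimately have "(\<gamma> s has_vector_derivative planar_field B C (\<gamma> s t)) (at t)" for t
      by metis
    moreover have "(\<gamma> s \<longlongrightarrow> (- s * - pi, pi / 2 + s * 0)) at_bot" "(\<gamma> s \<longlongrightarrow> (- s * pi, pi / 2 + s * 0)) at_top"
      unfolding \<gamma>_def by (intro tendsto_intros limX limY)+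
    ultimately show ?thesis
      using s by (auto simp: heteroclinic_orbit_def planar_field_def zero_prod_def)
  qed
  have bnd: "cell_boundary B C = p ` {..<2} \<union> (\<Union>i<2. range (\<gamma> (\<sigma> i)))"
  proof (intro equalityI subsetI)
    fix q assume q: "q \<in> cell_boundary B C"
    obtain x y where xy: "q = (x, pi / 2 + y)"
      by (metis diff_add_cancel prod.exhaust add.commute)
    have x: "\<bar>x\<bar> \<le> pi" and y: "\<bar>y\<bar> \<le> pi" and e: "B * cos x + C * cos y = C - B"
      using q assms by (auto simp: cell_boundary_def energy_alt xy)
    show "q \<in> p ` {..<2} \<union> (\<Union>i<2. range (\<gamma> (\<sigma> i)))"
    proof (cases "\<bar>x\<bar> = pi")
      case True
      then have "cos x = - 1" by (metis cos_abs_real cos_pi)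
      then have "cos y = cos 0" using e assms by simp
      then have "y = 0" using cos_abs_inj[of y 0] y by simp
      moreover have "x = pi \<or> x = - pi" using True by linarith
      ultimately have "q \<in> p ` {..<2}"
        by (auto simp: xy p_def image_iff lessThan_nat_numeral intro: bexI[of _ 0] bexI[of _ 1])
      then show ?thesis ..
    next
      case False
      then have x': "- (pi / 2) < x / 2" "x / 2 < pi / 2" using x by auto
      \<comment> \<open>Solves \<open>X t = x\<close>.\<close>
      define t where "t = arsinh (tan (x / 2) / m) / l"
      have Xt: "X t = x" using x' l m by (simp add: X_def t_def arctan_tan)
      then have "C * cos y = C * cos (Y t)" using e cosX[of t] unfolding Xt by linarith
      then have "cos y = cos (Y t)" using assms by simp
      moreover have "Y t \<ge> 0" "\<bar>Y t\<bar> \<le> pi"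
        using k m abs_double_arctan_less[of "k / (m * cosh (l * t))"] by (auto simp: Y_def)
      ultimately have "y = Y t \<or> y = - Y t" using cos_abs_inj[of y "Y t"] y by linarith
      then show ?thesis
      proof
        assume "y = Y t"
        \<comment> \<open>Time is reversed because the upper arc is run in the direction of
          decreasing \<open>x\<close>; \<open>X\<close> is odd and \<open>Y\<close> is even.\<close>
        then have "q = \<gamma> (\<sigma> 0) (- t)" by (simp add: \<sigma>_def \<gamma>_def xy flip: Xt) (simp add: X_def Y_def arctan_minus)
        then show ?thesis by (auto simp: lessThan_nat_numeral)
      next
        assume "y = - Y t"
        then have "q = \<gamma> (\<sigma> 1) t" by (simp add: \<sigma>_def \<gamma>_def xy Xt)
        then show ?thesis by (auto simp: lessThan_nat_numeral)
      qed
    qed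
  next
    fix q assume "q \<in> p ` {..<2} \<union> (\<Union>i<2. range (\<gamma> (\<sigma> i)))"
    then consider i where "q = p i" | i t where "q = \<gamma> (\<sigma> i) t" by auto
    then show "q \<in> cell_boundary B C"
    proof cases
      case 1
      then show ?thesis using assms by (auto simp: cell_boundary_def p_def energy_alt)
    next
      case 2
      have "\<bar>X t\<bar> \<le> pi" "\<bar>Y t\<bar> \<le> pi"
        using abs_double_arctan_less less_imp_le unfolding X_def Y_def by blast+
      then show ?thesis using assms cosX[of t] 2
        by (auto simp: cell_boundary_def \<gamma>_def \<sigma>_def energy_alt)
    qed
  qed
  show ?thesis
    unfolding heteroclinic_cycle_def
  proof (intro exI conjI allI impI)
    show "inj_on p {..<2}" by (auto simp: inj_on_def p_def)
    show "heteroclinic_orbit B C (p i) (p (Suc i mod 2)) (\<gamma> (\<sigma> i))" if "i < 2" for i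
    proof -
      have "i = 0 \<or> i = 1" using that by auto
      then show ?thesis using het[of 1] het[of "- 1"] by (auto simp: p_def \<sigma>_def)
    qed
  qed (simp_all add: bnd)
qed

text \<open>For equal parameters the constant \<open>m\<close> above degenerates to 0 and all four
  saddles have energy 0, so the cell is a square with straight sides. On one side the flow reduces
  to \<open>x' = - C * sin x\<close>, solved by \<open>tan (x / 2) = exp (- C * t)\<close>; the
  quarter turn is now a symmetry of the flow and supplies the other three sides.\<close>

lemma heteroclinic_cycle_eq:
  assumes "C > 0"
  shows "heteroclinic_cycle C C (cell_boundary C C)"
proof -
  define X where "X t = 2 * arctan (exp (- C * t))" for t
  define \<gamma> where "\<gamma> t = (X t, 3 * pi / 2 - X t)" for t
  define P :: "real \<times> real" where "P = (pi, pi / 2)"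
  have dX: "(X has_real_derivative - (C * sin (X t))) (at t)" for t
    unfolding X_def sin_double_arctan
    by (rule derivative_eq_intros refl)+ (simp add: field_simps)
  have "filterlim (\<lambda>t. - C * t) at_bot at_top" "filterlim (\<lambda>t. - C * t) at_top at_bot"
    using assms by real_asymp+
  note lin = this
  have lim0: "(X \<longlongrightarrow> 0) at_top"
  proof -
    have "((\<lambda>t. exp (- C * t)) \<longlongrightarrow> 0) at_top"
      by (rule filterlim_compose[OF exp_at_bot lin(1)])
    from tendsto_mult_left[OF tendsto_arctan[OF this], of 2] show ?thesis unfolding X_def by simp
  qed
  have limpi: "(X \<longlongrightarrow> pi) at_bot"
  proof -
    have "filterlim (\<lambda>t. exp (- C * t)) at_top at_bot"
      by (rule filterlim_compose[OF exp_at_top lin(2)])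
    from tendsto_mult_left[OF filterlim_compose[OF tendsto_arctan_at_top this], of 2]
    show ?thesis unfolding X_def by simp
  qed
  have surjX: "\<exists>t. X t = u" if u: "0 < u" "u < pi" for u
  proof
    have "tan (u / 2) > 0" using u by (intro tan_gt_zero) auto
    then show "X (- ln (tan (u / 2)) / C) = u"
      using assms u by (simp add: X_def arctan_tan)
  qed
  have rots: "quarter_turn P = (0, 3 * pi / 2)" "quarter_turn (0, 3 * pi / 2) = (- pi, pi / 2)"
     "quarter_turn (- pi, pi / 2) = (0, - (pi / 2))" "quarter_turn (0, - (pi / 2)) = P"
    by (auto simp: quarter_turn_def P_def)
  have "heteroclinic_orbit C C P (quarter_turn P) \<gamma>"
  proof -
    have "(\<gamma> has_vector_derivative (- C * sin (X t), - (- C * sin (X t)))) (at t)" for t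
      unfolding \<gamma>_def
      by (rule has_vector_derivative_Pair)
        (auto simp flip: has_real_derivative_iff_has_vector_derivative
          intro!: derivative_eq_intros dX)
    moreover have "(- C * sin (X t), - (- C * sin (X t))) = planar_field C C (\<gamma> t)" for t
      using cos_3over2_pi sin_3over2_pi by (auto simp: planar_field_def \<gamma>_def cos_diff)
    ultimately have "(\<gamma> has_vector_derivative planar_field C C (\<gamma> t)) (at t)" for t
      by metis
    moreover have "(\<gamma> \<longlongrightarrow> (pi, 3 * pi / 2 - pi)) at_bot" "(\<gamma> \<longlongrightarrow> (0, 3 * pi / 2 - 0)) at_top"
      unfolding \<gamma>_def by (intro tendsto_intros lim0 limpi)+
    ultimately show ?thesis
      unfolding heteroclinic_orbit_def rots using cos_3over2_pi
      by (simp add: P_def planar_field_def zero_prod_def)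
  qed
  \<comment> \<open>Each turn carries a side of the square to the next one, starting where the
    previous side ends.\<close>
  then have het: "heteroclinic_orbit C C ((quarter_turn ^^ i) P) ((quarter_turn ^^ Suc i) P) (\<lambda>t. (quarter_turn ^^ i) (\<gamma> t))" for i
    by (induction i) (use heteroclinic_orbit_quarter_turn in auto)
  have less4: "{..<4::nat} = {0, 1, 2, 3}"
    by (auto simp: lessThan_nat_numeral lessThan_Suc)
  have cycle4: "(quarter_turn ^^ 4) P = P"
    using rots by (simp add: eval_nat_numeral)
  have bnd: "cell_boundary C C = (\<lambda>i. (quarter_turn ^^ i) P) ` {..<4} \<union> (\<Union>i<4. range (\<lambda>t. (quarter_turn ^^ i) (\<gamma> t)))"
  proof (intro equalityI subsetI)
    fix q assume q: "q \<in> cell_boundary C C"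
    obtain x y where xy: "q = (x, pi / 2 + y)"
      by (metis diff_add_cancel prod.exhaust add.commute)
    have x: "\<bar>x\<bar> \<le> pi" and y: "\<bar>y\<bar> \<le> pi" and e: "C * cos x + C * cos y = 0"
      using q assms by (auto simp: cell_boundary_def energy_alt xy)
    have "cos y = cos (pi - \<bar>x\<bar>)" using e assms by (simp flip: distrib_left)
    then have "\<bar>y\<bar> = pi - \<bar>x\<bar>" using cos_abs_inj[of y "pi - \<bar>x\<bar>"] x y by simp
    then have ys: "y = pi - \<bar>x\<bar> \<or> y = \<bar>x\<bar> - pi" by linarith
    have xs: "x = pi \<or> x = - pi \<or> x = 0 \<or> (0 < x \<and> x < pi) \<or> (- pi < x \<and> x < 0)"
      using x by linarith
    have "(x = pi \<and> y = 0) \<or> (x = 0 \<and> y = pi) \<or> (x = - pi \<and> y = 0) \<or> (x = 0 \<and> y = - pi)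
      \<or> (0 < x \<and> x < pi \<and> y = pi - x) \<or> (- pi < x \<and> x < 0 \<and> y = pi + x)
      \<or> (- pi < x \<and> x < 0 \<and> y = - pi - x) \<or> (0 < x \<and> x < pi \<and> y = x - pi)"
      using xs ys by (elim disjE conjE) simp_all
    then consider "x = pi" "y = 0" | "x = 0" "y = pi" | "x = - pi" "y = 0" | "x = 0" "y = - pi"
      | "0 < x" "x < pi" "y = pi - x" | "- pi < x" "x < 0" "y = pi + x"
      | "- pi < x" "x < 0" "y = - pi - x" | "0 < x" "x < pi" "y = x - pi"
      by blast
    then have "(\<exists>i\<in>{..<4}. q = (quarter_turn ^^ i) P) \<or> (\<exists>i\<in>{..<4}. \<exists>t. q = (quarter_turn ^^ i) (\<gamma> t))"
    proof cases
      case 1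
      then have "q = (quarter_turn ^^ 0) P" by (simp add: xy P_def)
      then show ?thesis unfolding less4 by blast
    next
      case 2
      then have "q = (quarter_turn ^^ 1) P" using rots by (simp add: xy eval_nat_numeral)
      then show ?thesis unfolding less4 by blast
    next
      case 3
      then have "q = (quarter_turn ^^ 2) P" using rots by (simp add: xy eval_nat_numeral)
      then show ?thesis unfolding less4 by blast
    next
      case 4
      then have "q = (quarter_turn ^^ 3) P" using rots by (simp add: xy eval_nat_numeral)
      then show ?thesis unfolding less4 by blast
    next
      case 5
      obtain t where "X t = x" using surjX 5 by blast
      then have "q = (quarter_turn ^^ 0) (\<gamma> t)" using 5 by (simp add: xy \<gamma>_def)
      then show ?thesis unfolding less4 by blast
    next
      case 6
      obtain t where "X t = x + pi" using surjX[of "x + pi"] 6 by auto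
      then have "q = (quarter_turn ^^ 1) (\<gamma> t)" using 6 by (simp add: xy \<gamma>_def quarter_turn_def)
      then show ?thesis unfolding less4 by blast
    next
      case 7
      obtain t where "X t = - x" using surjX[of "- x"] 7 by auto
      then have "q = (quarter_turn ^^ 2) (\<gamma> t)" using 7 by (simp add: xy \<gamma>_def quarter_turn_def numeral_eq_Suc)
      then show ?thesis unfolding less4 by blast
    next
      case 8
      obtain t where "X t = pi - x" using surjX[of "pi - x"] 8 by auto
      then have "q = (quarter_turn ^^ 3) (\<gamma> t)" using 8 by (simp add: xy \<gamma>_def quarter_turn_def numeral_eq_Suc)
      then show ?thesis unfolding less4 by blast
    qed
    then show "q \<in> (\<lambda>i. (quarter_turn ^^ i) P) ` {..<4} \<union> (\<Union>i<4. range (\<lambda>t. (quarter_turn ^^ i) (\<gamma> t)))"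
      by blast
  next
    fix q assume q: "q \<in> (\<lambda>i. (quarter_turn ^^ i) P) ` {..<4} \<union> (\<Union>i<4. range (\<lambda>t. (quarter_turn ^^ i) (\<gamma> t)))"
    have inv: "(quarter_turn ^^ i) r \<in> cell_boundary C C" if "r \<in> cell_boundary C C" for i r
      by (induction i) (use that quarter_turn_cell_boundary[of C C] in auto)
    have "P \<in> cell_boundary C C" by (simp add: P_def cell_boundary_def energy_alt)
    moreover have "\<gamma> t \<in> cell_boundary C C" for t
    proof -
      have "0 \<le> X t" "X t \<le> pi"
        using abs_double_arctan_less[of "exp (- C * t)"] by (auto simp: X_def)
      then show ?thesis by (auto simp: cell_boundary_def \<gamma>_def energy_alt)
    qed
    ultimately show "q \<in> cell_boundary C C" using q inv by blast
  qed
  show ?thesis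
    unfolding heteroclinic_cycle_def
  proof (intro exI conjI allI impI)
    show "inj_on (\<lambda>i. (quarter_turn ^^ i) P) {..<4}"
      unfolding less4 by (auto simp: inj_on_def rots numeral_eq_Suc) (auto simp: P_def)
    show "heteroclinic_orbit C C ((quarter_turn ^^ i) P) ((quarter_turn ^^ (Suc i mod 4)) P) (\<lambda>t. (quarter_turn ^^ i) (\<gamma> t))"
      if "i < 4" for i
    proof (cases "i = 3")
      case True
      have "(quarter_turn ^^ Suc 3) P = P" using cycle4 by simp
      then show ?thesis using het[of 3] True by simp
    next
      case False
      then show ?thesis using het[of i] that by simp
    qed
  qed (simp_all add: bnd)
qed

lemma cell_cell_region:
  assumes "B > 0" "C > 0"
  shows "cell B C (cell_region B C)"
proof -
  have "heteroclinic_cycle B C (cell_boundary B C)"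
  proof (cases B C rule: linorder_cases)
    case greater
    then show ?thesis
      using heteroclinic_cycle_quarter_turn[OF heteroclinic_cycle_less, of C B] assms
      by (simp add: quarter_turn_cell_boundary)
  qed (use assms heteroclinic_cycle_less heteroclinic_cycle_eq in auto)
  then show ?thesis
    using assms inside_cell_boundary heteroclinic_not_in_cell_region unfolding cell_def by metis
qed

section \<open>Periodic solutions of nonresonant forced oscillators\<close>

lemma has_vector_derivative_sliding_integral:
  fixes h :: "real \<Rightarrow> 'a::banach"
  assumes h: "continuous_on UNIV h" and c: "0 \<le> c"
  shows "((\<lambda>z. integral {z..z + c} h) has_vector_derivative h (z + c) - h z) (at z)"
proof -
  \<comment> \<open>The base point lies to the left of \<open>z\<close>, so that \<open>z\<close> is
    interior to the range where \<open>P\<close> is differentiable, also when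
    \<open>c = 0\<close>.\<close>
  define P where "P u = integral {z - 1..u} h" for u
  have int: "h integrable_on {a..b}" for a b
    by (intro integrable_continuous_real continuous_on_subset[OF h]) auto
  have dP: "(P has_vector_derivative h u) (at u)" if "u > z - 1" for u
  proof -
    have "(P has_vector_derivative h u) (at u within {z - 1..u + 1})"
      unfolding P_def using that
      by (intro integral_has_vector_derivative continuous_on_subset[OF h]) auto
    then have "(P has_vector_derivative h u) (at u within {z - 1<..<u + 1})"
      by (rule has_vector_derivative_within_subset) auto
    then show ?thesis
      using that has_vector_derivative_within_open[of u "{z - 1<..<u + 1}"] by auto
  qed
  have "((\<lambda>z. P (z + c)) has_vector_derivative 1 *\<^sub>R h (z + c)) (at z)"
    by (rule vector_diff_chain_at[unfolded o_def, of "\<lambda>z. z + c"])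
      (use c in \<open>auto intro!: derivative_eq_intros dP\<close>)
  then have d: "((\<lambda>z. P (z + c) - P z) has_vector_derivative h (z + c) - h z) (at z)"
    using dP[of z] by (auto intro!: derivative_eq_intros)
  have e: "P (u + c) - P u = integral {u..u + c} h" if "u \<in> {z - 1<..}" for u
    unfolding P_def using that c int
      Henstock_Kurzweil_Integration.integral_combine[of "z - 1" u "u + c" h]
    by (auto simp: algebra_simps)
  show ?thesis
    by (rule has_vector_derivative_transform_within_open[OF d open_greaterThan[of "z - 1"] _ e]) auto
qed

text \<open>
  The periodic solutions of \<open>W' = \<i>\<omega>W + G(s, W)\<close> are the fixed points of
  \<open>W \<mapsto> (\<lambda>z. (e\<^sup>-\<^sup>\<i>\<^sup>\<omega>\<^sup>p - 1)\<^sup>-\<^sup>1 \<integral> e\<^sup>\<i>\<^sup>\<omega>\<^sup>(\<^sup>z\<^sup>-\<^sup>s\<^sup>) G(s, W(s)) ds)\<close>, the integral extending over \<open>[z, z + p]\<close>.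
  The radius \<open>\<rho>\<close> is twice the norm bound of the image of \<open>W = 0\<close>.
\<close>

lemma forced_oscillator_periodic_solution:
  fixes G :: "real \<Rightarrow> complex \<Rightarrow> complex" and \<omega> p m \<epsilon> :: real
  defines "\<kappa> \<equiv> norm (inverse (cis (- \<omega> * p) - 1))"
  defines "\<rho> \<equiv> 2 * p * \<kappa> * m"
  assumes p: "0 < p" and nonres: "cis (- \<omega> * p) \<noteq> 1" and m: "0 \<le> m" and \<epsilon>: "0 \<le> \<epsilon>"
    and cont: "continuous_on (UNIV \<times> cball 0 \<rho>) (\<lambda>(s, w). G s w)"
    and per: "\<And>s w. G (s + p) w = G s w"
    and bound: "\<And>s. norm (G s 0) \<le> m"
    and lip: "\<And>s w w'. norm w \<le> \<rho> \<Longrightarrow> norm w' \<le> \<rho> \<Longrightarrow> norm (G s w - G s w') \<le> \<epsilon> * norm (w - w')"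
    and small: "p * \<kappa> * \<epsilon> \<le> 1 / 2"
  obtains W where "\<And>s. W (s + p) = W s" "\<And>s. norm (W s) \<le> \<rho>"
    "\<And>s. (W has_vector_derivative \<i> * \<omega> * W s + G s (W s)) (at s)"
proof -
  define K where "K = inverse (cis (- \<omega> * p) - 1)"
  have "K * (cis (- \<omega> * p) - 1) = 1" using nonres by (simp add: K_def)
  then have K: "norm K = \<kappa>" "K * cis (- \<omega> * p) - K = 1" "0 \<le> \<kappa>"
    by (simp_all add: K_def \<kappa>_def right_diff_distrib)
  have \<rho>: "\<rho> \<ge> 0" using p m K by (simp add: \<rho>_def)
  \<comment> \<open>Periodicity belongs to the space, because the image under \<open>T\<close>
    satisfies the differential equation only for periodic \<open>w\<close>.\<close>
  define S where "S = {w :: real \<Rightarrow>\<^sub>C complex. \<forall>s. w (s + p) = w s \<and> norm (w s) \<le> \<rho>}"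
  define T where "T w z = K * (cis (\<omega> * z) * integral {z..z + p} (\<lambda>s. cis (- \<omega> * s) * G s (w s)))"
    for w :: "real \<Rightarrow> complex" and z
  have hcont: "continuous_on A (\<lambda>s. cis (- \<omega> * s) * G s (w s))" if "w \<in> S" for w :: "real \<Rightarrow>\<^sub>C complex" and A
  proof -
    have "continuous_on UNIV (\<lambda>s. (\<lambda>(s, w). G s w) (s, w s))"
      using that by (intro continuous_on_compose2[OF cont] continuous_intros) (auto simp: S_def)
    then have "continuous_on UNIV (\<lambda>s. cis (- \<omega> * s) * G s (w s))"
      by (intro continuous_intros) auto
    then show ?thesis by (rule continuous_on_subset) auto
  qed
  have int: "(\<lambda>s. cis (- \<omega> * s) * G s (w s)) integrable_on {a..b}" if "w \<in> S" for w :: "real \<Rightarrow>\<^sub>C complex" and a b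
    by (intro integrable_continuous_real hcont that)
  have shift: "cis (- \<omega> * (s + p)) * G (s + p) (w (s + p)) = cis (- \<omega> * p) * (cis (- \<omega> * s) * G s (w s))"
    if "w \<in> S" for w :: "real \<Rightarrow>\<^sub>C complex" and s
  proof -
    have "cis (- \<omega> * (s + p)) = cis (- \<omega> * p) * cis (- \<omega> * s)"
      unfolding cis_mult by (simp add: algebra_simps)
    moreover have "w (s + p) = w s" using that by (simp add: S_def)
    ultimately show ?thesis by (simp add: per)
  qed
  have deriv: "(T w has_vector_derivative \<i> * \<omega> * T w z + G z (w z)) (at z)" if w: "w \<in> S" for w :: "real \<Rightarrow>\<^sub>C complex" and z
  proof -
    define h where "h = (\<lambda>s. cis (- \<omega> * s) * G s (w s))"
    define J where "J z = integral {z..z + p} h" for z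
    have dJ: "(J has_vector_derivative h (z + p) - h z) (at z)"
      unfolding J_def using hcont[OF w] p
      by (intro has_vector_derivative_sliding_integral) (auto simp: h_def)
    have dcis: "((\<lambda>z. cis (\<omega> * z)) has_vector_derivative \<omega> *\<^sub>R (\<i> * cis (\<omega> * z))) (at z)"
    proof -
      have "((\<lambda>u. exp (\<i> * \<omega> * u)) has_field_derivative \<omega> *\<^sub>R (\<i> * cis (\<omega> * z))) (at (of_real z))"
        by (auto intro!: derivative_eq_intros simp: cis_conv_exp scaleR_conv_of_real algebra_simps)
      from has_vector_derivative_real_field[OF this] show ?thesis
        by (simp add: cis_conv_exp mult.assoc)
    qed
    have hp: "h (z + p) = cis (- \<omega> * p) * h z"
      unfolding h_def by (rule shift[OF w])
    have cc: "cis (\<omega> * z) * h z = G z (w z)"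
      by (simp add: h_def mult.assoc[symmetric] cis_mult)
    have "(T w has_vector_derivative
        K * (cis (\<omega> * z) * (h (z + p) - h z) + \<omega> *\<^sub>R (\<i> * cis (\<omega> * z)) * J z)) (at z)"
      unfolding T_def[abs_def] h_def[symmetric] J_def[symmetric]
      by (intro has_vector_derivative_mult_right has_vector_derivative_mult dJ dcis)
    \<comment> \<open>A shift by one period multiplies \<open>h\<close> by
      \<open>cis (- \<omega> * p)\<close>. The two boundary terms combine to a multiple of
      \<open>h z\<close>, and \<open>K\<close> is chosen to make the coefficient 1.\<close>
    also have "K * (cis (\<omega> * z) * (h (z + p) - h z) + \<omega> *\<^sub>R (\<i> * cis (\<omega> * z)) * J z)
       = (K * cis (- \<omega> * p) - K) * (cis (\<omega> * z) * h z) + \<i> * \<omega> * (K * (cis (\<omega> * z) * J z))"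
      unfolding hp by (simp add: scaleR_conv_of_real algebra_simps)
    also have "\<dots> = \<i> * \<omega> * T w z + G z (w z)"
      unfolding K cc by (simp add: T_def J_def h_def)
    finally show ?thesis .
  qed
  have perT: "T w (z + p) = T w z" if w: "w \<in> S" for w :: "real \<Rightarrow>\<^sub>C complex" and z
  proof -
    define h where "h = (\<lambda>s. cis (- \<omega> * s) * G s (w s))"
    have hp: "h (s + p) = cis (- \<omega> * p) * h s" for s
      unfolding h_def by (rule shift[OF w])
    have "integral {z + p..z + p + p} h = integral {z..z + p} (\<lambda>s. h (s + p))"
      using integral_shift_cbox[of "z + p" p "z + p + p" h] by (simp add: ac_simps)
    also have "\<dots> = cis (- \<omega> * p) * integral {z..z + p} h"
      unfolding hp by simp
    finally show ?thesis
      unfolding T_def h_def[symmetric]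
      by (simp add: distrib_left mult.assoc[symmetric] cis_mult)
  qed
  have Gb: "norm (G s w) \<le> m + \<epsilon> * \<rho>" if "norm w \<le> \<rho>" for s w
  proof -
    have "norm (G s w) \<le> norm (G s 0) + norm (G s w - G s 0)"
      by (metis add.commute diff_add_cancel norm_triangle_ineq)
    also have "\<dots> \<le> m + \<epsilon> * norm (w - 0)"
      using that \<rho> by (intro add_mono bound lip) auto
    finally show ?thesis using mult_left_mono[OF that \<epsilon>] by simp
  qed
  have boundT: "norm (T w z) \<le> \<rho>" if w: "w \<in> S" for w :: "real \<Rightarrow>\<^sub>C complex" and z
  proof -
    have "norm (integral {z..z + p} (\<lambda>s. cis (- \<omega> * s) * G s (w s))) \<le> (m + \<epsilon> * \<rho>) * (z + p - z)"
      using w p by (intro integral_bound hcont) (auto simp: norm_mult S_def intro!: Gb)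
    then have "norm (T w z) \<le> \<kappa> * ((m + \<epsilon> * \<rho>) * p)"
      unfolding T_def using K by (simp add: norm_mult mult_left_mono)
    \<comment> \<open>Half of the radius bounds the image of 0; the contraction factor 1/2 leaves
      the other half for the dependence on \<open>w\<close>.\<close>
    also have "\<dots> = \<rho> / 2 + (p * \<kappa> * \<epsilon>) * \<rho>" by (simp add: \<rho>_def algebra_simps)
    also have "\<dots> \<le> \<rho>" using mult_right_mono[OF small \<rho>] by simp
    finally show ?thesis .
  qed
  have lipT: "norm (T v z - T w z) \<le> 1 / 2 * norm (v - w)" if vw: "v \<in> S" "w \<in> S"
    for v w :: "real \<Rightarrow>\<^sub>C complex" and z
  proof -
    let ?h = "\<lambda>w s. cis (- \<omega> * s) * G s (apply_bcontfun w s)"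
    have b: "norm (?h v s - ?h w s) \<le> \<epsilon> * norm (v - w)" for s
    proof -
      have "norm (?h v s - ?h w s) = norm (G s (v s) - G s (w s))"
        by (simp add: norm_mult flip: right_diff_distrib)
      also have "\<dots> \<le> \<epsilon> * norm (v s - w s)" using vw by (intro lip) (auto simp: S_def)
      also have "\<dots> \<le> \<epsilon> * norm (v - w)"
        using norm_bounded[of "v - w" s] \<epsilon> by (intro mult_left_mono) auto
      finally show ?thesis .
    qed
    have "norm (integral {z..z + p} (\<lambda>s. ?h v s - ?h w s)) \<le> \<epsilon> * norm (v - w) * (z + p - z)"
      using vw p by (intro integral_bound continuous_on_diff hcont b) auto
    moreover have "T v z - T w z = K * (cis (\<omega> * z) * integral {z..z + p} (\<lambda>s. ?h v s - ?h w s))"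
      unfolding T_def Henstock_Kurzweil_Integration.integral_diff[OF int[OF vw(1)] int[OF vw(2)]]
      by (simp add: right_diff_distrib)
    ultimately have "norm (T v z - T w z) \<le> \<kappa> * (\<epsilon> * norm (v - w) * p)"
      using K by (simp add: norm_mult mult_left_mono)
    also have "\<dots> = (p * \<kappa> * \<epsilon>) * norm (v - w)" by simp
    also have "\<dots> \<le> 1 / 2 * norm (v - w)" by (intro mult_right_mono small) auto
    finally show ?thesis .
  qed
  have contT: "T w \<in> bcontfun" if "w \<in> S" for w :: "real \<Rightarrow>\<^sub>C complex"
    using deriv[OF that] boundT[OF that]
    by (intro bcontfun_normI continuous_on_vector_derivative[where f' = "\<lambda>z. \<i> * \<omega> * T w z + G z (w z)"])
      (auto intro: has_vector_derivative_at_within)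
  then have app: "apply_bcontfun (Bcontfun (T w)) = T w" if "w \<in> S" for w :: "real \<Rightarrow>\<^sub>C complex"
    using that by (simp add: Bcontfun_inverse)
  have "closed S"
  proof -
    have ev: "continuous_on UNIV (\<lambda>w :: real \<Rightarrow>\<^sub>C complex. apply_bcontfun w s)" for s
      unfolding continuous_on_iff
    proof (intro ballI allI impI)
      fix w :: "real \<Rightarrow>\<^sub>C complex" and e :: real assume "0 < e"
      then show "\<exists>d>0. \<forall>v\<in>UNIV. dist v w < d \<longrightarrow> dist (apply_bcontfun v s) (apply_bcontfun w s) < e"
        using dist_bounded le_less_trans by blast
    qed
    have "S = (\<Inter>s. {w :: real \<Rightarrow>\<^sub>C complex. w (s + p) = w s}) \<inter> (\<Inter>s. {w :: real \<Rightarrow>\<^sub>C complex. norm (w s) \<le> \<rho>})"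
      by (auto simp: S_def)
    moreover have "closed {w :: real \<Rightarrow>\<^sub>C complex. w (s + p) = w s}" "closed {w :: real \<Rightarrow>\<^sub>C complex. norm (w s) \<le> \<rho>}" for s
      by (intro closed_Collect_eq closed_Collect_le continuous_intros ev)+
    ultimately show ?thesis by (simp add: closed_INT closed_Int)
  qed
  then have "complete S" by (simp add: complete_eq_closed)
  moreover have "0 \<in> S" using \<rho> by (simp add: S_def)
  moreover have "(\<lambda>w. Bcontfun (T (apply_bcontfun w))) ` S \<subseteq> S"
  proof
    fix v assume "v \<in> (\<lambda>w. Bcontfun (T (apply_bcontfun w))) ` S"
    then obtain w where w: "w \<in> S" "apply_bcontfun v = T w" using app by auto
    then show "v \<in> S" using perT boundT by (simp add: S_def)
  qed
  ultimately have "\<exists>!w\<in>S. Bcontfun (T (apply_bcontfun w)) = w"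
  proof (intro Banach_fix[where c = "1 / 2"])
    fix v w assume "v \<in> S" "w \<in> S"
    then show "dist (Bcontfun (T (apply_bcontfun v))) (Bcontfun (T (apply_bcontfun w))) \<le> 1 / 2 * dist v w"
      using lipT by (intro dist_bound) (simp add: app dist_norm)
  qed auto
  then obtain w where w: "w \<in> S" "Bcontfun (T (apply_bcontfun w)) = w" by auto
  then have "apply_bcontfun w = T w" using app by metis
  then show thesis using that[of "apply_bcontfun w"] w(1) deriv[OF w(1)]
    by (auto simp: S_def)
qed

section \<open>The periodic orbits parametrised by z\<close>

definition speed :: "real \<Rightarrow> real \<Rightarrow> real \<Rightarrow> real \<Rightarrow> real" where
  "speed B C X Y = C * cos Y + B * cos X"

text \<open>
  With \<open>z\<close> as the independent variable and \<open>y = \<pi>/2 + Y\<close>, both components of the vector field have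
  the form \<open>(\<beta> + c sin u) / D\<close>, where \<open>D\<close> is the speed and \<open>S = B + C\<close> is the value of \<open>D\<close> at the
  centre. Subtracting the linear part \<open>c u / S\<close> leaves a small Lipschitz constant.
\<close>

definition quot_rhs :: "real \<Rightarrow> real \<Rightarrow> real \<Rightarrow> real \<Rightarrow> real \<Rightarrow> real" where
  "quot_rhs S D \<beta> c u = (\<beta> + c * sin u) / D - c * u / S"

section \<open>Lipschitz estimates near the centre\<close>

lemma abs_diff_mult_le:
  fixes u v u' v' :: real
  shows "\<bar>u * v - u' * v'\<bar> \<le> \<bar>u\<bar> * \<bar>v - v'\<bar> + \<bar>u - u'\<bar> * \<bar>v'\<bar>"
proof -
  have "u * v - u' * v' = u * (v - v') + (u - u') * v'" by (simp add: algebra_simps)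
  then show ?thesis by (metis abs_mult abs_triangle_ineq)
qed

text \<open>The gain of the factor \<open>r\<close> is due to the cosine being flat at 0; it makes
  the speed vary only to second order near the centre.\<close>

lemma abs_cos_diff_le:
  fixes u v r :: real
  assumes "\<bar>u\<bar> \<le> r" "\<bar>v\<bar> \<le> r"
  shows "\<bar>cos u - cos v\<bar> \<le> r * \<bar>u - v\<bar>"
proof -
  have "\<bar>cos u - cos v\<bar> = 2 * (\<bar>sin ((u + v) / 2)\<bar> * \<bar>sin ((v - u) / 2)\<bar>)"
    by (simp add: cos_diff_cos abs_mult)
  also have "\<dots> \<le> 2 * (\<bar>(u + v) / 2\<bar> * \<bar>(v - u) / 2\<bar>)"
    by (intro mult_left_mono mult_mono abs_sin_x_le_abs_x) auto
  also have "\<dots> \<le> 2 * (r * \<bar>(v - u) / 2\<bar>)"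
    using assms by (intro mult_left_mono mult_right_mono) auto
  finally show ?thesis by (simp add: abs_minus_commute)
qed

lemma one_minus_cos_le_abs: "1 - cos (u::real) \<le> \<bar>u\<bar>"
proof -
  have "1 - cos u = 2 * (\<bar>sin (u / 2)\<bar> * \<bar>sin (u / 2)\<bar>)"
    using cos_diff_cos[of 0 u] by (simp add: power2_eq_square flip: abs_mult)
  also have "\<dots> \<le> 2 * (\<bar>u / 2\<bar> * 1)"
    by (intro mult_left_mono mult_mono abs_sin_x_le_abs_x) auto
  finally show ?thesis by simp
qed

lemma abs_sin_minus_id_diff_le:
  fixes u v r :: real
  assumes "\<bar>u\<bar> \<le> r" "\<bar>v\<bar> \<le> r"
  shows "\<bar>(sin u - u) - (sin v - v)\<bar> \<le> r * \<bar>u - v\<bar>"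
proof -
  have "norm ((sin u - u) - (sin v - v)) \<le> r * norm (u - v)"
  proof (rule field_differentiable_bound[where S = "{-r..r}" and f' = "\<lambda>x. cos x - 1"])
    fix x assume x: "x \<in> {-r..r}"
    show "norm (cos x - 1) \<le> r" using one_minus_cos_le_abs[of x] x by auto
    show "((\<lambda>x. sin x - x) has_field_derivative cos x - 1) (at x within {-r..r})"
      by (auto intro!: derivative_eq_intros)
  qed (use assms in auto)
  then show ?thesis by simp
qed

text \<open>With the normalised quantities \<open>e = S / D\<close>, \<open>b = \<beta> / S\<close>
  and \<open>k = c / S\<close>, the remainder equals
  \<open>b * e + k * ((sin u - u) * e + u * (e - 1))\<close>. Every product here gains a factor
  \<open>r\<close>: from the smallness of \<open>b\<close>, from the cubic tangency of the sine, or
  from \<open>e\<close> being close to 1. The three terms contribute 4, 6 and 6 to the constant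
  16.\<close>

lemma quot_rhs_lipschitz:
  fixes S D D' \<beta> c u u' r d :: real
  assumes S: "S > 0" and D: "S / 2 \<le> D" "S / 2 \<le> D'" "\<bar>S - D\<bar> \<le> r * S" "\<bar>S - D'\<bar> \<le> r * S"
    and DD: "\<bar>D - D'\<bar> \<le> r * S * d" and uu: "\<bar>u - u'\<bar> \<le> d" and u: "\<bar>u\<bar> \<le> r" "\<bar>u'\<bar> \<le> r"
    and r: "r \<le> 1" and \<beta>: "\<bar>\<beta>\<bar> \<le> r * S" and c: "\<bar>c\<bar> \<le> S"
  shows "\<bar>quot_rhs S D \<beta> c u - quot_rhs S D' \<beta> c u'\<bar> \<le> 16 * r * d"
proof -
  have pos: "D > 0" "D' > 0" "d \<ge> 0" "r \<ge> 0" using S D uu u by linarith+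
  define e e' b k where "e = S / D" and "e' = S / D'" and "b = \<beta> / S" and "k = c / S"
  have e: "0 \<le> e" "e \<le> 2" "0 \<le> e'" "e' \<le> 2"
    using S D pos by (auto simp: e_def e'_def field_simps)
  have "e - 1 = (S - D) / D" "e' - 1 = (S - D') / D'"
    using pos by (simp_all add: e_def e'_def diff_divide_distrib)
  then have "\<bar>e - 1\<bar> = \<bar>S - D\<bar> / D" "\<bar>e' - 1\<bar> = \<bar>S - D'\<bar> / D'"
    using pos by simp_all
  moreover have "\<bar>S - D\<bar> / D \<le> 2 * r" "\<bar>S - D'\<bar> / D' \<le> 2 * r"
    using D pos mult_left_mono[OF D(1), of "2 * r"] mult_left_mono[OF D(2), of "2 * r"]
    by (auto simp: divide_le_eq)
  ultimately have e1: "\<bar>e - 1\<bar> \<le> 2 * r" "\<bar>e' - 1\<bar> \<le> 2 * r" by simp_all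
  have ee: "\<bar>e - e'\<bar> \<le> 4 * r * d"
  proof -
    have "e - e' = (D' - D) * e * e' / S"
      using pos S by (simp add: e_def e'_def field_simps)
    then have "\<bar>e - e'\<bar> = \<bar>D - D'\<bar> * (e * e') / S"
      using e S by (simp add: abs_mult abs_minus_commute)
    also have "\<dots> \<le> (r * S * d) * (2 * 2) / S"
      using S DD e pos by (intro divide_right_mono mult_mono) auto
    finally show ?thesis using S by simp
  qed
  have b: "\<bar>b\<bar> \<le> r" and k: "\<bar>k\<bar> \<le> 1"
    using \<beta> c S by (simp_all add: b_def k_def field_simps)
  have rr: "r * (4 * r * d) \<le> 1 * (4 * r * d)"
    using r pos by (intro mult_right_mono) auto
  have 1: "\<bar>b * (e - e')\<bar> \<le> 4 * r * d"
  proof -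
    have "\<bar>b * (e - e')\<bar> \<le> r * (4 * r * d)"
      unfolding abs_mult using b ee pos by (intro mult_mono) auto
    then show ?thesis using rr by linarith
  qed
  have 2: "\<bar>(sin u - u) * e - (sin u' - u') * e'\<bar> \<le> 6 * r * d"
  proof -
    have "\<bar>sin u - u\<bar> \<le> r * \<bar>u\<bar>"
      using abs_sin_minus_id_diff_le[of u r 0] u pos by simp
    also have "\<dots> \<le> r * 1" using u r pos by (intro mult_left_mono) auto
    finally have "\<bar>sin u - u\<bar> * \<bar>e - e'\<bar> \<le> r * (4 * r * d)"
      using ee pos by (intro mult_mono) auto
    moreover have "\<bar>(sin u - u) - (sin u' - u')\<bar> \<le> r * d"
      using abs_sin_minus_id_diff_le[OF u] mult_left_mono[OF uu, of r] pos by linarith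
    then have "\<bar>(sin u - u) - (sin u' - u')\<bar> * \<bar>e'\<bar> \<le> (r * d) * 2"
      using e pos by (intro mult_mono) auto
    ultimately show ?thesis
      using abs_diff_mult_le[of "sin u - u" e "sin u' - u'" e'] rr by linarith
  qed
  have 3: "\<bar>u * (e - 1) - u' * (e' - 1)\<bar> \<le> 6 * r * d"
  proof -
    have "\<bar>u\<bar> * \<bar>(e - 1) - (e' - 1)\<bar> \<le> r * (4 * r * d)"
      using u ee pos by (intro mult_mono) auto
    moreover have "\<bar>u - u'\<bar> * \<bar>e' - 1\<bar> \<le> d * (2 * r)"
      using uu e1 pos by (intro mult_mono) auto
    ultimately show ?thesis
      using abs_diff_mult_le[of u "e - 1" u' "e' - 1"] rr by (simp add: mult_ac)
  qed
  have "quot_rhs S D \<beta> c u - quot_rhs S D' \<beta> c u' =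
      b * (e - e') + k * (((sin u - u) * e - (sin u' - u') * e') + (u * (e - 1) - u' * (e' - 1)))"
    using S pos unfolding quot_rhs_def b_def k_def e_def e'_def by (simp add: field_simps)
  also have "\<bar>\<dots>\<bar> \<le> 4 * r * d + 1 * (6 * r * d + 6 * r * d)"
  proof (rule order_trans[OF abs_triangle_ineq], intro add_mono 1)
    have "\<bar>((sin u - u) * e - (sin u' - u') * e') + (u * (e - 1) - u' * (e' - 1))\<bar> \<le> 6 * r * d + 6 * r * d"
      using 2 3 by linarith
    then show "\<bar>k * (((sin u - u) * e - (sin u' - u') * e') + (u * (e - 1) - u' * (e' - 1)))\<bar>
        \<le> 1 * (6 * r * d + 6 * r * d)"
      unfolding abs_mult using k by (intro mult_mono) auto
  qed
  finally show ?thesis by (simp add: mult_ac)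
qed

text \<open>The linearisation at the centre is \<open>X' = - q\<^sup>2 * Y\<close>,
  \<open>Y' = p\<^sup>2 * X\<close>, an elliptic rotation. In the complex variable with real part
  \<open>p * X\<close> and imaginary part \<open>q * Y\<close> it becomes a circular one with
  frequency \<open>p * q\<close>, as the oscillator lemma requires.\<close>

lemma reduced_periodic_orbits:
  fixes B C :: real
  assumes "B > 0" "C > 0"
  obtains A0 K where "A0 > 0" "K > 0"
    "\<And>A. 0 \<le> A \<Longrightarrow> A \<le> A0 \<Longrightarrow> \<exists>X Y. \<forall>s. X (s + 2 * pi) = X s \<and> Y (s + 2 * pi) = Y s \<and>
       \<bar>X s\<bar> \<le> K * A \<and> \<bar>Y s\<bar> \<le> K * A \<and>
       (X has_real_derivative (A * sin s - C * sin (Y s)) / speed B C (X s) (Y s)) (at s) \<and>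
       (Y has_real_derivative (B * sin (X s) + A * cos s) / speed B C (X s) (Y s)) (at s)"
proof -
  define S p q where "S = B + C" and "p = sqrt (B / S)" and "q = sqrt (C / S)"
  define \<omega> where "\<omega> = p * q"
  have S: "S > 0" using assms by (simp add: S_def)
  have p: "0 < p" "p \<le> 1" "p\<^sup>2 = B / S" and q: "0 < q" "q \<le> 1" "q\<^sup>2 = C / S"
    using assms by (auto simp: p_def q_def S_def)
  have pq: "p\<^sup>2 + q\<^sup>2 = 1"
    using S unfolding p q by (simp add: S_def flip: add_divide_distrib)
  \<comment> \<open>From \<open>2 * p * q \<le> p\<^sup>2 + q\<^sup>2 = 1\<close>. The rotation
    angle over a period thus lies in \<open>{0<..pi}\<close>, where the cosine is below 1.\<close>
  have \<omega>: "0 < \<omega>" "\<omega> \<le> 1 / 2"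
    using p q pq zero_le_power2[of "p - q"] by (auto simp: \<omega>_def power2_diff)
  have nonres: "cis (- \<omega> * (2 * pi)) \<noteq> 1"
  proof
    assume "cis (- \<omega> * (2 * pi)) = 1"
    then have "cos (\<omega> * (2 * pi)) = 1" by (simp add: complex_eq_iff)
    moreover have "cos (\<omega> * (2 * pi)) < cos 0"
      using \<omega> by (intro cos_monotone_0_pi) auto
    ultimately show False by simp
  qed
  define \<kappa> where "\<kappa> = norm (inverse (cis (- \<omega> * (2 * pi)) - 1))"
  have \<kappa>: "\<kappa> > 0" using nonres by (simp add: \<kappa>_def)
  define L where "L = 1 / p + 1 / q"
  have L: "L > 0" using p q by (simp add: L_def add_pos_pos)
  \<comment> \<open>The second bound is the contraction condition
    \<open>2 * pi * \<kappa> * (32 * r * L) \<le> 1 / 2\<close>, where 32 is twice the constant 16,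
    once per component, and \<open>L\<close> is the cost of passing from the complex norm to
    \<open>\<bar>X\<bar> + \<bar>Y\<bar>\<close>. The first bound keeps the speed above
    \<open>S / 2\<close>.\<close>
  define r where "r = min (1 / 2) (1 / (128 * pi * \<kappa> * L))"
  have r: "0 < r" "r \<le> 1 / 2" "r \<le> 1 / (128 * pi * \<kappa> * L)"
    using \<kappa> L by (auto simp: r_def)
  have rL: "128 * pi * \<kappa> * L * r \<le> 1"
    using r(3) \<kappa> L by (simp add: le_divide_eq mult_ac)
  have r1: "r \<le> 1" using r by simp
  have BC: "\<bar>B\<bar> \<le> S" "\<bar>- C\<bar> \<le> S" using assms by (auto simp: S_def)
  \<comment> \<open>The first bound makes the forcing at most \<open>r * S\<close>; the second is
    equivalent to \<open>\<rho> \<le> r * p * q\<close>, which places \<open>X\<close> and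
    \<open>Y\<close> within \<open>r\<close> of 0.\<close>
  define A0 where "A0 = min (r * S) (r * p * q * S / (8 * pi * \<kappa>))"
  define K where "K = 8 * pi * \<kappa> / (S * p * q)"
  have A0: "A0 > 0" and K: "K > 0" using r S p q \<kappa> by (auto simp: A0_def K_def)
  show thesis
  proof (rule that[OF A0 K])
    fix A assume A: "0 \<le> A" "A \<le> A0"
    then have A1: "A \<le> r * S" and A2: "A \<le> r * p * q * S / (8 * pi * \<kappa>)" by (auto simp: A0_def)
    \<comment> \<open>The radius of the oscillator lemma for period \<open>2 * pi\<close> and
      forcing bound \<open>2 * A / S\<close>; it is proportional to \<open>A\<close>.\<close>
    define \<rho> where "\<rho> = 2 * (2 * pi) * \<kappa> * (2 * A / S)"
    have \<rho>: "\<rho> \<le> r * p * q"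
      using A2 S \<kappa> by (simp add: \<rho>_def field_simps)
    have \<rho>0: "\<rho> \<ge> 0" using A S \<kappa> by (simp add: \<rho>_def)
    define X Y where "X w = Re w / p" and "Y w = Im w / q" for w
    define D where "D w = speed B C (X w) (Y w)" for w
    define F1 F2 where "F1 s w = quot_rhs S (D w) (A * sin s) (- C) (Y w)"
      and "F2 s w = quot_rhs S (D w) (A * cos s) B (X w)" for s w
    define G where "G s w = Complex (p * F1 s w) (q * F2 s w)" for s w
    have XY0: "\<bar>X w\<bar> \<le> norm w / p" "\<bar>Y w\<bar> \<le> norm w / q" for w
      using p q abs_Re_le_cmod[of w] abs_Im_le_cmod[of w]
      by (auto simp: X_def Y_def intro: divide_right_mono)
    have XY: "\<bar>X w\<bar> \<le> r" "\<bar>Y w\<bar> \<le> r" if "norm w \<le> \<rho>" for w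
    proof -
      have "norm w / p \<le> r * q" "norm w / q \<le> r * p"
        using that \<rho> p q by (auto simp: divide_le_eq mult_ac)
      moreover have "r * q \<le> r" "r * p \<le> r" using r p q by auto
      ultimately show "\<bar>X w\<bar> \<le> r" "\<bar>Y w\<bar> \<le> r" using XY0[of w] by linarith+
    qed
    have SD: "\<bar>S - D w\<bar> \<le> r * S" "S / 2 \<le> D w" if "norm w \<le> \<rho>" for w
    proof -
      have "S - D w = C * (1 - cos (Y w)) + B * (1 - cos (X w))"
        by (simp add: S_def D_def speed_def algebra_simps)
      moreover have "C * (1 - cos (Y w)) \<le> C * r" "B * (1 - cos (X w)) \<le> B * r"
        using assms XY[OF that] one_minus_cos_le_abs[of "X w"] one_minus_cos_le_abs[of "Y w"]
        by (auto intro!: mult_left_mono)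
      moreover have "0 \<le> C * (1 - cos (Y w))" "0 \<le> B * (1 - cos (X w))"
        using assms by auto
      ultimately show 1: "\<bar>S - D w\<bar> \<le> r * S" by (simp add: S_def algebra_simps)
      have "r * S \<le> 1 / 2 * S" using r S by (intro mult_right_mono) auto
      then show "S / 2 \<le> D w" using 1 by linarith
    qed
    have lip: "norm (G s w - G s w') \<le> 32 * r * L * norm (w - w')" if w: "norm w \<le> \<rho>" "norm w' \<le> \<rho>" for s w w'
    proof -
      define d where "d = \<bar>X w - X w'\<bar> + \<bar>Y w - Y w'\<bar>"
      have d: "\<bar>X w - X w'\<bar> \<le> d" "\<bar>Y w - Y w'\<bar> \<le> d" "d \<ge> 0" by (auto simp: d_def)
      have "\<bar>D w - D w'\<bar> \<le> \<bar>C * (cos (Y w) - cos (Y w'))\<bar> + \<bar>B * (cos (X w) - cos (X w'))\<bar>"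
        unfolding D_def speed_def right_diff_distrib by linarith
      also have "\<dots> \<le> C * (r * \<bar>Y w - Y w'\<bar>) + B * (r * \<bar>X w - X w'\<bar>)"
        using assms XY[OF w(1)] XY[OF w(2)]
        by (auto simp: abs_mult intro!: add_mono mult_left_mono abs_cos_diff_le)
      also have "\<dots> \<le> C * (r * d) + B * (r * d)"
        using assms r d by (intro add_mono mult_left_mono) auto
      finally have DD: "\<bar>D w - D w'\<bar> \<le> r * S * d" by (simp add: S_def algebra_simps)
      have A': "\<bar>A * sin s\<bar> \<le> r * S" "\<bar>A * cos s\<bar> \<le> r * S"
        using A A1 mult_left_mono[OF abs_sin_le_one[of s] A(1)] mult_left_mono[OF abs_cos_le_one[of s] A(1)]
        by (simp_all add: abs_mult)
      have F': "\<bar>F1 s w - F1 s w'\<bar> \<le> 16 * r * d" "\<bar>F2 s w - F2 s w'\<bar> \<le> 16 * r * d"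
        unfolding F1_def F2_def
        using quot_rhs_lipschitz[OF S SD(2)[OF w(1)] SD(2)[OF w(2)] SD(1)[OF w(1)] SD(1)[OF w(2)]
            DD d(2) XY(2)[OF w(1)] XY(2)[OF w(2)] r1 A'(1) BC(2)]
          quot_rhs_lipschitz[OF S SD(2)[OF w(1)] SD(2)[OF w(2)] SD(1)[OF w(1)] SD(1)[OF w(2)]
            DD d(1) XY(1)[OF w(1)] XY(1)[OF w(2)] r1 A'(2) BC(1)]
        by blast+
      have F: "p * \<bar>F1 s w - F1 s w'\<bar> \<le> 1 * (16 * r * d)" "q * \<bar>F2 s w - F2 s w'\<bar> \<le> 1 * (16 * r * d)"
        using mult_mono[OF p(2) F'(1)] mult_mono[OF q(2) F'(2)] by simp_all
      have "norm (G s w - G s w') \<le> \<bar>Re (G s w - G s w')\<bar> + \<bar>Im (G s w - G s w')\<bar>"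
        by (rule cmod_le)
      also have "\<dots> = p * \<bar>F1 s w - F1 s w'\<bar> + q * \<bar>F2 s w - F2 s w'\<bar>"
        using p q by (simp add: G_def abs_mult flip: right_diff_distrib)
      also have "\<dots> \<le> 32 * r * d" using F by simp
      also have "d = \<bar>X (w - w')\<bar> + \<bar>Y (w - w')\<bar>"
        by (simp add: d_def X_def Y_def diff_divide_distrib)
      also have "\<dots> \<le> L * norm (w - w')"
        using XY0[of "w - w'"] by (simp add: L_def algebra_simps)
      finally show ?thesis using r by (simp add: mult_ac)
    qed
    obtain W where perW: "\<And>s. W (s + 2 * pi) = W s" and boundW: "\<And>s. norm (W s) \<le> \<rho>"
      and derW: "\<And>s. (W has_vector_derivative \<i> * \<omega> * W s + G s (W s)) (at s)"
    proof (rule forced_oscillator_periodic_solution[of "2 * pi" \<omega> "2 * A / S" "32 * r * L" G, folded \<kappa>_def, folded \<rho>_def])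
      show "continuous_on (UNIV \<times> cball 0 \<rho>) (\<lambda>(s, w). G s w)"
      proof -
        have "D w \<noteq> 0" if "norm w \<le> \<rho>" for w using SD[OF that] S by linarith
        then have "continuous_on (UNIV \<times> cball 0 \<rho>) (\<lambda>z. Complex (p * F1 (fst z) (snd z)) (q * F2 (fst z) (snd z)))"
          using S p q unfolding F1_def F2_def quot_rhs_def D_def speed_def X_def Y_def
          by (intro continuous_intros) auto
        then show ?thesis by (simp add: G_def case_prod_beta)
      qed
      show "G (s + 2 * pi) w = G s w" for s w by (simp add: G_def F1_def F2_def)
      show "norm (G s 0) \<le> 2 * A / S" for s
      proof -
        have D0: "D 0 = S" by (simp add: D_def speed_def X_def Y_def S_def)
        have "norm (G s 0) \<le> \<bar>Re (G s 0)\<bar> + \<bar>Im (G s 0)\<bar>" by (rule cmod_le)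
        also have "\<dots> = p * (A * \<bar>sin s\<bar> / S) + q * (A * \<bar>cos s\<bar> / S)"
          using p q A S by (simp add: G_def F1_def F2_def quot_rhs_def D0 X_def Y_def abs_mult)
        also have "\<dots> \<le> 1 * (A * 1 / S) + 1 * (A * 1 / S)"
          using p q A S by (intro add_mono mult_mono divide_right_mono) auto
        finally show ?thesis by simp
      qed
      show "2 * pi * \<kappa> * (32 * r * L) \<le> 1 / 2" using rL by (simp add: mult_ac)
    qed (use nonres A S r L lip in auto)
    show "\<exists>X Y. \<forall>s. X (s + 2 * pi) = X s \<and> Y (s + 2 * pi) = Y s \<and>
       \<bar>X s\<bar> \<le> K * A \<and> \<bar>Y s\<bar> \<le> K * A \<and>
       (X has_real_derivative (A * sin s - C * sin (Y s)) / speed B C (X s) (Y s)) (at s) \<and>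
       (Y has_real_derivative (B * sin (X s) + A * cos s) / speed B C (X s) (Y s)) (at s)"
    proof (intro exI allI conjI)
      fix s
      show "X (W (s + 2 * pi)) = X (W s)" "Y (W (s + 2 * pi)) = Y (W s)" by (simp_all add: perW)
      have "\<rho> / p \<le> \<rho> / (p * q)" "\<rho> / q \<le> \<rho> / (p * q)"
        using \<rho>0 p q by (auto intro!: divide_left_mono)
      moreover have "\<rho> / (p * q) = K * A" by (simp add: \<rho>_def K_def)
      moreover have "norm (W s) / p \<le> \<rho> / p" "norm (W s) / q \<le> \<rho> / q"
        using p q boundW by (auto intro!: divide_right_mono)
      ultimately show "\<bar>X (W s)\<bar> \<le> K * A" "\<bar>Y (W s)\<bar> \<le> K * A" using XY0[of "W s"] by linarith+
      have "((\<lambda>s. Re (W s)) has_real_derivative Re (\<i> * \<omega> * W s + G s (W s))) (at s)"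
        using bounded_linear.has_vector_derivative[OF bounded_linear_Re derW]
        by (simp add: has_real_derivative_iff_has_vector_derivative)
      then have "((\<lambda>s. X (W s)) has_real_derivative Re (\<i> * \<omega> * W s + G s (W s)) / p) (at s)"
        unfolding X_def by (rule DERIV_cdivide)
      \<comment> \<open>The rotation restores the linear part that \<open>quot_rhs\<close>
        subtracts.\<close>
      moreover have "Re (\<i> * \<omega> * W s + G s (W s)) / p = F1 s (W s) - q\<^sup>2 * Y (W s)"
        using p(1) q(1) by (simp add: G_def Y_def \<omega>_def power2_eq_square field_simps)
      moreover have "F1 s (W s) - q\<^sup>2 * Y (W s) = (A * sin s - C * sin (Y (W s))) / speed B C (X (W s)) (Y (W s))"
        unfolding q F1_def quot_rhs_def D_def by simp
      ultimately show "((\<lambda>s. X (W s)) has_real_derivative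
          (A * sin s - C * sin (Y (W s))) / speed B C (X (W s)) (Y (W s))) (at s)" by simp
      have "((\<lambda>s. Im (W s)) has_real_derivative Im (\<i> * \<omega> * W s + G s (W s))) (at s)"
        using bounded_linear.has_vector_derivative[OF bounded_linear_Im derW]
        by (simp add: has_real_derivative_iff_has_vector_derivative)
      then have "((\<lambda>s. Y (W s)) has_real_derivative Im (\<i> * \<omega> * W s + G s (W s)) / q) (at s)"
        unfolding Y_def by (rule DERIV_cdivide)
      moreover have "Im (\<i> * \<omega> * W s + G s (W s)) / q = F2 s (W s) + p\<^sup>2 * X (W s)"
        using p(1) q(1) by (simp add: G_def X_def \<omega>_def power2_eq_square field_simps)
      moreover have "F2 s (W s) + p\<^sup>2 * X (W s) = (B * sin (X (W s)) + A * cos s) / speed B C (X (W s)) (Y (W s))"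
        unfolding p F2_def quot_rhs_def D_def by simp
      ultimately show "((\<lambda>s. Y (W s)) has_real_derivative
          (B * sin (X (W s)) + A * cos s) / speed B C (X (W s)) (Y (W s))) (at s)" by simp
    qed
  qed
qed

section \<open>Return to the time variable\<close>

lemma periodic_continuous_bounded:
  fixes g :: "real \<Rightarrow> real"
  assumes cont: "continuous_on UNIV g" and per: "\<And>s. g (s + p) = g s" and p: "p > 0"
  obtains M where "\<And>s. \<bar>g s\<bar> \<le> M"
proof -
  interpret periodic_fun_simple g p by standard (rule per)
  have "bounded (g ` {0..p})"
    by (intro compact_imp_bounded compact_continuous_image continuous_on_subset[OF cont]) auto
  then obtain M where M: "\<forall>s\<in>{0..p}. \<bar>g s\<bar> \<le> M"
    unfolding bounded_iff by auto
  have "\<bar>g s\<bar> \<le> M" for s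
  proof -
    define k where "k = \<lfloor>s / p\<rfloor>"
    have "of_int k \<le> s / p" "s / p < of_int k + 1" by (auto simp: k_def)
    then have "s - of_int k * p \<in> {0..p}" using p by (auto simp: field_simps)
    moreover have "g (s - of_int k * p) = g s" by (rule minus_of_int)
    ultimately show ?thesis using M by metis
  qed
  then show thesis by (rule that)
qed

text \<open>Separation of variables: an antiderivative \<tau> of \<open>1 / w\<close> is the time at
  which the solution reaches a given point, and \<open>z\<close> is its inverse. Every period takes
  the same time \<open>T\<close>, so \<tau> differs from the linear function of slope
  \<open>T / p\<close> by a bounded periodic one, and the mean speed is
  \<open>p / T\<close>.\<close>

lemma periodic_autonomous_flow:
  fixes w :: "real \<Rightarrow> real" and a b p c :: real
  assumes cont: "continuous_on UNIV w" and per: "\<And>s. w (s + p) = w s" and p: "p > 0"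
    and a: "a > 0" and w: "\<And>s. a \<le> w s" "\<And>s. w s \<le> b"
  shows "\<exists>z v. z 0 = c \<and> (\<forall>t. (z has_real_derivative w (z t)) (at t)) \<and> strict_mono z \<and>
    ((\<lambda>t. z t / t) \<longlongrightarrow> v) at_top \<and> a \<le> v \<and> v \<le> b"
proof -
  have wpos: "w s > 0" for s using w(1)[of s] a by linarith
  have b: "b > 0" using wpos[of 0] w(2)[of 0] by linarith
  have "isCont (\<lambda>s. inverse (w s)) s" for s
    using cont wpos[of s] by (intro continuous_intros) (auto simp: continuous_on_eq_continuous_at)
  then have "\<exists>F. \<forall>s. (F has_vector_derivative inverse (w s)) (at s)"
    using einterval_antiderivative[of "- \<infinity>" \<infinity> "\<lambda>s. inverse (w s)"] by simp
  then obtain F where F: "\<And>s. (F has_real_derivative inverse (w s)) (at s)"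
    by (auto simp: has_real_derivative_iff_has_vector_derivative)
  define \<tau> where "\<tau> s = F s - F c" for s
  have d\<tau>: "(\<tau> has_real_derivative inverse (w s)) (at s)" for s
    unfolding \<tau>_def by (auto intro!: derivative_eq_intros F)
  have lower: "(s' - s) / b \<le> \<tau> s' - \<tau> s" if "s \<le> s'" for s s'
  proof -
    have "\<tau> s - s / b \<le> \<tau> s' - s' / b"
    proof (rule DERIV_nonneg_imp_nondecreasing[OF that])
      fix u
      have "((\<lambda>s. \<tau> s - s / b) has_real_derivative inverse (w u) - 1 / b) (at u)"
        using b by (auto intro!: derivative_eq_intros d\<tau>)
      moreover have "1 / b \<le> inverse (w u)"
        using w(2)[of u] wpos[of u] by (simp add: inverse_eq_divide frac_le)
      ultimately show "\<exists>y. ((\<lambda>s. \<tau> s - s / b) has_real_derivative y) (at u) \<and> 0 \<le> y"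
        by (intro exI[of _ "inverse (w u) - 1 / b"]) simp
    qed
    then show ?thesis by (simp add: diff_divide_distrib)
  qed
  have upper: "\<tau> s' - \<tau> s \<le> (s' - s) / a" if "s \<le> s'" for s s'
  proof -
    have "s / a - \<tau> s \<le> s' / a - \<tau> s'"
    proof (rule DERIV_nonneg_imp_nondecreasing[OF that])
      fix u
      have "((\<lambda>s. s / a - \<tau> s) has_real_derivative 1 / a - inverse (w u)) (at u)"
        using a by (auto intro!: derivative_eq_intros d\<tau>)
      moreover have "inverse (w u) \<le> 1 / a"
        using w(1)[of u] a by (simp add: inverse_eq_divide frac_le)
      ultimately show "\<exists>y. ((\<lambda>s. s / a - \<tau> s) has_real_derivative y) (at u) \<and> 0 \<le> y"
        by (intro exI[of _ "1 / a - inverse (w u)"]) simp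
    qed
    then show ?thesis by (simp add: diff_divide_distrib)
  qed
  have mono: "\<tau> s < \<tau> s'" if "s < s'" for s s'
  proof -
    have "0 < (s' - s) / b" using that b by simp
    then show ?thesis using lower[of s s'] that by linarith
  qed
  have cont\<tau>: "continuous_on S \<tau>" for S
    by (meson DERIV_continuous_on d\<tau> has_field_derivative_at_within)
  have "\<exists>s. \<tau> s = t" for t
  proof -
    have \<tau>0: "\<tau> c = 0" by (simp add: \<tau>_def)
    have "\<bar>t\<bar> \<le> \<tau> (c + b * \<bar>t\<bar>)" "\<tau> (c - b * \<bar>t\<bar>) \<le> - \<bar>t\<bar>"
      using lower[of c "c + b * \<bar>t\<bar>"] lower[of "c - b * \<bar>t\<bar>" c] b \<tau>0 by auto
    then show ?thesis
      using IVT'[of \<tau> "c - b * \<bar>t\<bar>" t "c + b * \<bar>t\<bar>"] b cont\<tau> by force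
  qed
  then obtain z where z: "\<And>t. \<tau> (z t) = t" by metis
  have z_mono: "z t < z t'" if "t < t'" for t t'
    using mono[of "z t'" "z t"] that z by (metis linorder_neqE less_asym)
  have z\<tau>: "z (\<tau> s) = s" for s
    using mono z by (metis less_irrefl linorder_neqE)
  have "isCont z t" for t
  proof -
    \<comment> \<open>The slope of \<tau> is at least \<open>1 / b\<close>, so its inverse expands
      distances by at most \<open>b\<close>; this gives the continuity needed for differentiating
      the inverse.\<close>
    have "b-lipschitz_on UNIV z"
    proof (rule lipschitz_onI)
      fix t t'
      have "b * (t' - t) \<le> b * \<bar>t - t'\<bar>" "b * (t - t') \<le> b * \<bar>t - t'\<bar>"
        using b by (auto intro!: mult_left_mono)
      moreover have "z t' - z t \<le> b * (t' - t)" if "z t \<le> z t'"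
        using lower[OF that] b by (simp add: z divide_le_eq mult.commute)
      moreover have "z t - z t' \<le> b * (t - t')" if "z t' \<le> z t"
        using lower[OF that] b by (simp add: z divide_le_eq mult.commute)
      ultimately show "dist (z t) (z t') \<le> b * dist t t'"
        unfolding dist_real_def by linarith
    qed (use b in simp)
    then show ?thesis
      using lipschitz_on_continuous_on continuous_on_eq_continuous_at by blast
  qed
  then have dz: "(z has_real_derivative w (z t)) (at t)" for t
    using DERIV_inverse_function[where f = \<tau> and g = z and x = t and D = "inverse (w (z t))"
        and a = "t - 1" and b = "t + 1"] d\<tau> z wpos[of "z t"]
    by simp
  define T where "T = \<tau> p - \<tau> 0"
  have T: "\<tau> (s + p) - \<tau> s = T" for s
  proof -
    have "((\<lambda>s. \<tau> (s + p) - \<tau> s) has_real_derivative 0) (at u)" for u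
    proof -
      have "((\<lambda>s. \<tau> (s + p)) has_real_derivative inverse (w (u + p))) (at u)"
        using DERIV_shift[of \<tau> "inverse (w (u + p))" u p] d\<tau> by blast
      then show ?thesis using d\<tau>[of u] per[of u]
        by (auto intro!: derivative_eq_intros)
    qed
    from DERIV_isconst_all[of "\<lambda>s. \<tau> (s + p) - \<tau> s"] this
    have "\<tau> (s + p) - \<tau> s = \<tau> (0 + p) - \<tau> 0" by blast
    then show ?thesis by (simp add: T_def)
  qed
  have Tb: "p / b \<le> T" "T \<le> p / a"
    using lower[of 0 p] upper[of 0 p] p by (auto simp: T_def)
  have Tpos: "T > 0" using Tb(1) p b by (meson divide_pos_pos less_le_trans)
  define g where "g s = \<tau> s - T / p * s" for s
  obtain M where M: "\<And>s. \<bar>g s\<bar> \<le> M"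
  proof (rule periodic_continuous_bounded[of g p])
    show "continuous_on UNIV g" unfolding g_def by (intro continuous_intros cont\<tau>)
    show "g (s + p) = g s" for s using T[of s] p by (simp add: g_def field_simps)
  qed (use p in auto)
  \<comment> \<open>Since \<open>t = \<tau> (z t) = T / p * z t + g (z t)\<close>, division by
    \<open>t\<close> leaves only this term as an error.\<close>
  have "((\<lambda>t. g (z t) * (1 / t)) \<longlongrightarrow> 0) at_top"
  proof (rule Lim_null_comparison)
    show "((\<lambda>t::real. M / t) \<longlongrightarrow> 0) at_top" by real_asymp
    show "\<forall>\<^sub>F t in at_top. norm (g (z t) * (1 / t)) \<le> M / t"
      using eventually_gt_at_top[of 0]
      by eventually_elim (use M in \<open>auto simp: divide_right_mono\<close>)
  qed
  then have "((\<lambda>t. p / T * (1 - g (z t) * (1 / t))) \<longlongrightarrow> p / T * (1 - 0)) at_top"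
    by (intro tendsto_intros)
  moreover have "\<forall>\<^sub>F t in at_top. p / T * (1 - g (z t) * (1 / t)) = z t / t"
    using eventually_gt_at_top[of 0]
  proof eventually_elim
    case (elim t)
    have "t - g (z t) = T / p * z t" using z[of t] by (simp add: g_def)
    then show ?case using elim p Tpos by (simp add: field_simps)
  qed
  ultimately have lim: "((\<lambda>t. z t / t) \<longlongrightarrow> p / T) at_top"
    by (simp add: tendsto_cong)
  show ?thesis
  proof (intro exI conjI allI)
    show "z 0 = c" using z\<tau>[of c] by (simp add: \<tau>_def)
    show "strict_mono z" using z_mono by (simp add: strict_mono_def)
    show "a \<le> p / T" "p / T \<le> b"
      using Tb Tpos p a b by (auto simp: field_simps)
  qed (use dz lim in auto)
qed

section \<open>Smoothness of solutions\<close>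

text \<open>The class has to contain the derivative of \<open>f\<close> but not \<open>f\<close>
  itself. This suits \<open>z\<close>, which is unbounded and thus is no trigonometric polynomial in
  bounded sines and cosines.\<close>

lemma smoothI:
  assumes closed: "\<And>g. g \<in> P \<Longrightarrow> \<exists>g'\<in>P. \<forall>t. (g has_real_derivative g' t) (at t)"
    and g: "g \<in> P" and f: "\<And>t. (f has_real_derivative g t) (at t)"
  shows "smooth f"
proof -
  have deriv_eq: "deriv h = h'" if "\<And>t. (h has_real_derivative h' t) (at t)" for h h' :: "real \<Rightarrow> real"
    using that by (auto intro: DERIV_imp_deriv)
  have iter: "(deriv ^^ n) g \<in> P" for n
  proof (induction n)
    case (Suc n)
    then obtain g' where "g' \<in> P" "\<And>t. ((deriv ^^ n) g has_real_derivative g' t) (at t)"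
      using closed by blast
    then show ?case using deriv_eq[of "(deriv ^^ n) g" g'] by simp
  qed (simp add: g)
  have "(deriv ^^ n) f differentiable (at t)" for n t
  proof (cases n)
    case 0
    then show ?thesis using f[of t] by (auto simp: real_differentiable_def)
  next
    case (Suc m)
    have "(deriv ^^ n) f = (deriv ^^ m) g"
      using deriv_eq[of f g] f by (simp add: Suc funpow_Suc_right del: funpow.simps)
    then show ?thesis
      using closed[OF iter[of m]] by (auto simp: real_differentiable_def)
  qed
  then show ?thesis by (simp add: smooth_def)
qed

inductive_set trig_polynomials :: "(real \<Rightarrow> real) set \<Rightarrow> (real \<Rightarrow> real) set" for F where
  const: "(\<lambda>t. c) \<in> trig_polynomials F"
| sin: "f \<in> F \<Longrightarrow> (\<lambda>t. sin (f t)) \<in> trig_polynomials F"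
| cos: "f \<in> F \<Longrightarrow> (\<lambda>t. cos (f t)) \<in> trig_polynomials F"
| add: "g \<in> trig_polynomials F \<Longrightarrow> h \<in> trig_polynomials F \<Longrightarrow> (\<lambda>t. g t + h t) \<in> trig_polynomials F"
| mult: "g \<in> trig_polynomials F \<Longrightarrow> h \<in> trig_polynomials F \<Longrightarrow> (\<lambda>t. g t * h t) \<in> trig_polynomials F"

text \<open>The chain rule brings out the derivative of a generator, which the differential equation
  expresses within the same class; the product rule does the rest.\<close>

lemma trig_polynomials_derivative:
  assumes F: "\<And>f. f \<in> F \<Longrightarrow> \<exists>f'\<in>trig_polynomials F. \<forall>t. (f has_real_derivative f' t) (at t)"
    and "g \<in> trig_polynomials F"
  shows "\<exists>g'\<in>trig_polynomials F. \<forall>t. (g has_real_derivative g' t) (at t)"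
  using assms(2)
proof (induction rule: trig_polynomials.induct)
  case (const c)
  show ?case by (rule bexI[of _ "\<lambda>t. 0"]) (auto intro: trig_polynomials.const)
next
  case (sin f)
  then obtain f' where f': "f' \<in> trig_polynomials F" "\<And>t. (f has_real_derivative f' t) (at t)"
    using F by blast
  show ?case
    by (rule bexI[of _ "\<lambda>t. cos (f t) * f' t"])
      (auto intro!: trig_polynomials.mult trig_polynomials.cos f' sin derivative_eq_intros)
next
  case (cos f)
  then obtain f' where f': "f' \<in> trig_polynomials F" "\<And>t. (f has_real_derivative f' t) (at t)"
    using F by blast
  show ?case
  proof (rule bexI)
    show "(\<lambda>t. (- 1) * (sin (f t) * f' t)) \<in> trig_polynomials F"
      by (intro trig_polynomials.mult trig_polynomials.const trig_polynomials.sin f' cos)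
    show "\<forall>t. ((\<lambda>t. cos (f t)) has_real_derivative (- 1) * (sin (f t) * f' t)) (at t)"
      by (auto intro!: derivative_eq_intros f')
  qed
next
  case (add g h)
  then obtain g' h' where "g' \<in> trig_polynomials F" "h' \<in> trig_polynomials F"
    "\<And>t. (g has_real_derivative g' t) (at t)" "\<And>t. (h has_real_derivative h' t) (at t)" by blast
  then show ?case
    by (intro bexI[of _ "\<lambda>t. g' t + h' t"])
      (auto intro!: trig_polynomials.add derivative_eq_intros)
next
  case (mult g h)
  then obtain g' h' where *: "g' \<in> trig_polynomials F" "h' \<in> trig_polynomials F"
    "\<And>t. (g has_real_derivative g' t) (at t)" "\<And>t. (h has_real_derivative h' t) (at t)" by blast
  show ?case
    by (rule bexI[of _ "\<lambda>t. g' t * h t + h' t * g t"])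
      (auto intro!: trig_polynomials.add trig_polynomials.mult * mult.hyps derivative_eq_intros)
qed

lemma abc_solution_smooth:
  assumes "abc_solution A B C x y z"
  shows "smooth x" "smooth y" "smooth z"
proof -
  let ?P = "trig_polynomials {x, y, z}"
  have P: "(\<lambda>t. A * sin (z t) + C * cos (y t)) \<in> ?P" "(\<lambda>t. B * sin (x t) + A * cos (z t)) \<in> ?P"
    "(\<lambda>t. C * sin (y t) + B * cos (x t)) \<in> ?P"
    by (auto intro!: trig_polynomials.intros)
  have d: "\<forall>t. (x has_real_derivative A * sin (z t) + C * cos (y t)) (at t)"
    "\<forall>t. (y has_real_derivative B * sin (x t) + A * cos (z t)) (at t)"
    "\<forall>t. (z has_real_derivative C * sin (y t) + B * cos (x t)) (at t)"
    using assms by (auto simp: abc_solution_def)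
  have "\<exists>f'\<in>?P. \<forall>t. (f has_real_derivative f' t) (at t)" if "f \<in> {x, y, z}" for f
  proof -
    from that consider "f = x" | "f = y" | "f = z" by blast
    then show ?thesis
    proof cases
      case 1
      show ?thesis unfolding 1 by (rule bexI[OF _ P(1)]) (rule d(1))
    next
      case 2
      show ?thesis unfolding 2 by (rule bexI[OF _ P(2)]) (rule d(2))
    next
      case 3
      show ?thesis unfolding 3 by (rule bexI[OF _ P(3)]) (rule d(3))
    qed
  qed
  note closed = trig_polynomials_derivative[OF this]
  show "smooth x" "smooth y" "smooth z"
    using smoothI[OF closed P(1)] smoothI[OF closed P(2)] smoothI[OF closed P(3)] d by blast+
qed

section \<open>The family of ballistic spiral orbits\<close>

text \<open>The periodic curve depends on \<open>A\<close> alone and \<open>z0\<close> only selects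
  the starting point on it, whence constants independent of \<open>z0\<close>. Along the curve the
  speed lies between \<open>S * (1 - L * A)\<close> and \<open>S\<close>, and so does its
  mean.\<close>

lemma ballistic_spiral_family:
  fixes B C :: real
  assumes "B > 0" "C > 0"
  shows "\<exists>A0 K. A0 > 0 \<and> K > 0 \<and> (\<forall>A z0. 0 \<le> A \<longrightarrow> A \<le> A0 \<longrightarrow> (\<exists>x y z v.
       abc_solution A B C x y z \<and> z 0 = z0 \<and> strict_mono z \<and>
       ((\<lambda>t. z t / t) \<longlongrightarrow> v) at_top \<and> periodic_in z x \<and> periodic_in z y \<and>
       spiral_orbit B C x y z \<and> v > 0 \<and> \<bar>v - (B + C)\<bar> \<le> K * A))"
proof -
  obtain A1 L where A1: "A1 > 0" and L: "L > 0" and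
    orb: "\<And>A. 0 \<le> A \<Longrightarrow> A \<le> A1 \<Longrightarrow> \<exists>X Y. \<forall>s. X (s + 2 * pi) = X s \<and> Y (s + 2 * pi) = Y s \<and>
       \<bar>X s\<bar> \<le> L * A \<and> \<bar>Y s\<bar> \<le> L * A \<and>
       (X has_real_derivative (A * sin s - C * sin (Y s)) / speed B C (X s) (Y s)) (at s) \<and>
       (Y has_real_derivative (B * sin (X s) + A * cos s) / speed B C (X s) (Y s)) (at s)"
    using reduced_periodic_orbits[OF assms] by metis
  define S where "S = B + C"
  have S: "S > 0" using assms by (simp add: S_def)
  have "(0, pi / 2) \<in> cell_region B C"
    using assms by (auto simp: cell_region_def energy_def)
  then obtain e where e: "e > 0" "ball (0, pi / 2) e \<subseteq> cell_region B C"
    using open_cell_region open_contains_ball by blast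
  \<comment> \<open>Two coordinates of size \<open>e / 3\<close> stay strictly inside the ball of
    radius \<open>e\<close>.\<close>
  have in_cell: "(X, pi / 2 + Y) \<in> cell_region B C" if "\<bar>X\<bar> \<le> e / 3" "\<bar>Y\<bar> \<le> e / 3" for X Y
  proof -
    have "dist (0, pi / 2) (X, pi / 2 + Y) \<le> \<bar>X\<bar> + \<bar>Y\<bar>"
      using sqrt_sum_squares_le_sum_abs[of X Y] by (simp add: dist_prod_def dist_real_def)
    then have "(X, pi / 2 + Y) \<in> ball (0, pi / 2) e" using that e by simp
    then show ?thesis using e by blast
  qed
  \<comment> \<open>The bound \<open>e / 3\<close> keeps the orbit in the cell, and 1/2 keeps the
    lower bound of the speed positive.\<close>
  define A0 where "A0 = min A1 (min (e / 3) (1 / 2) / L)"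
  have A0: "A0 > 0" "S * L > 0" using A1 L e S by (auto simp: A0_def)
  show ?thesis
  proof (rule exI[of _ A0], rule exI[of _ "S * L"], intro conjI A0 allI impI)
    fix A z0 assume A: "0 \<le> A" "A \<le> A0"
    have LA: "L * A \<le> e / 3" "L * A \<le> 1 / 2"
    proof -
      have "A \<le> min (e / 3) (1 / 2) / L" using A by (simp add: A0_def)
      then have "L * A \<le> min (e / 3) (1 / 2)" using L by (simp add: le_divide_eq mult.commute)
      then show "L * A \<le> e / 3" "L * A \<le> 1 / 2" by simp_all
    qed
    obtain X Y where per: "\<And>s. X (s + 2 * pi) = X s" "\<And>s. Y (s + 2 * pi) = Y s"
      and bound: "\<And>s. \<bar>X s\<bar> \<le> L * A" "\<And>s. \<bar>Y s\<bar> \<le> L * A"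
      and dX: "\<And>s. (X has_real_derivative (A * sin s - C * sin (Y s)) / speed B C (X s) (Y s)) (at s)"
      and dY: "\<And>s. (Y has_real_derivative (B * sin (X s) + A * cos s) / speed B C (X s) (Y s)) (at s)"
      using orb[of A] A by (auto simp: A0_def)
    define w where "w s = speed B C (X s) (Y s)" for s
    have w_lower: "S * (1 - L * A) \<le> w s" for s
    proof -
      have "1 - L * A \<le> cos (X s)" "1 - L * A \<le> cos (Y s)"
        using one_minus_cos_le_abs[of "X s"] one_minus_cos_le_abs[of "Y s"] bound[of s] by linarith+
      then have "C * (1 - L * A) \<le> C * cos (Y s)" "B * (1 - L * A) \<le> B * cos (X s)"
        using assms by auto
      then show ?thesis by (simp add: w_def speed_def S_def algebra_simps)
    qed
    have w_upper: "w s \<le> S" for s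
    proof -
      have "C * cos (Y s) \<le> C * 1" "B * cos (X s) \<le> B * 1"
        using assms by (intro mult_left_mono; simp)+
      then show ?thesis by (simp add: w_def speed_def S_def)
    qed
    have pos: "S * (1 - L * A) > 0" using S LA by simp
    have contXY: "continuous_on UNIV X" "continuous_on UNIV Y"
      using dX dY by (auto intro!: DERIV_isCont continuous_at_imp_continuous_on)
    have contw: "continuous_on UNIV w"
      unfolding w_def speed_def by (intro continuous_intros contXY)
    have perw: "w (s + 2 * pi) = w s" for s by (simp add: w_def per)
    have two_pi: "0 < 2 * pi" by simp
    obtain z v where z0: "z 0 = z0" and dz: "\<And>t. (z has_real_derivative w (z t)) (at t)"
      and mono: "strict_mono z" and lim: "((\<lambda>t. z t / t) \<longlongrightarrow> v) at_top"
      and v: "S * (1 - L * A) \<le> v" "v \<le> S"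
      using periodic_autonomous_flow[OF contw perw two_pi pos w_lower w_upper, where c = z0] by blast
    define x y where "x t = X (z t)" and "y t = pi / 2 + Y (z t)" for t
    have wz: "w (z t) \<noteq> 0" for t using w_lower[of "z t"] pos by linarith
    have "abc_solution A B C x y z"
      unfolding abc_solution_def
    proof (intro allI conjI)
      fix t
      \<comment> \<open>By the chain rule the speed cancels the denominator introduced by using
        \<open>z\<close> as the independent variable.\<close>
      have "((\<lambda>t. X (z t)) has_real_derivative (A * sin (z t) - C * sin (Y (z t))) / w (z t) * w (z t)) (at t)"
        unfolding w_def using DERIV_chain2[OF dX dz] by (simp add: w_def)
      then show "(x has_real_derivative A * sin (z t) + C * cos (y t)) (at t)"
        using wz[of t] by (simp add: x_def[abs_def] y_def cos_add)
      have "((\<lambda>t. pi / 2 + Y (z t)) has_real_derivative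
          0 + (B * sin (X (z t)) + A * cos (z t)) / w (z t) * w (z t)) (at t)"
        unfolding w_def by (rule DERIV_add[OF DERIV_const]) (use DERIV_chain2[OF dY dz] in \<open>simp add: w_def\<close>)
      then show "(y has_real_derivative B * sin (x t) + A * cos (z t)) (at t)"
        using wz[of t] by (simp add: x_def y_def[abs_def])
      show "(z has_real_derivative C * sin (y t) + B * cos (x t)) (at t)"
        using dz[of t] by (simp add: w_def speed_def x_def y_def sin_add)
    qed
    moreover have "periodic_in z x" "periodic_in z y"
      unfolding periodic_in_def
      by (rule exI[of _ X], simp add: per x_def) (rule exI[of _ "\<lambda>s. pi / 2 + Y s"], simp add: per y_def)
    moreover have "spiral_orbit B C x y z"
    proof -
      have "(x t, y t) \<in> cell_region B C" for t
        unfolding x_def y_def using bound[of "z t"] LA by (intro in_cell) auto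
      then show ?thesis
        using mono cell_cell_region[OF assms] by (auto simp: spiral_orbit_def)
    qed
    moreover have "v > 0" "\<bar>v - (B + C)\<bar> \<le> S * L * A"
      using v pos by (auto simp: S_def algebra_simps)
    ultimately show "\<exists>x y z v.
       abc_solution A B C x y z \<and> z 0 = z0 \<and> strict_mono z \<and>
       ((\<lambda>t. z t / t) \<longlongrightarrow> v) at_top \<and> periodic_in z x \<and> periodic_in z y \<and>
       spiral_orbit B C x y z \<and> v > 0 \<and> \<bar>v - (B + C)\<bar> \<le> S * L * A"
      using z0 mono lim by blast
  qed
qed

theorem theorem2p1:
  fixes B C :: real
  assumes "B > 0" and "C > 0"
  shows "\<exists>A0>0. \<exists>x y z :: real \<Rightarrow> real \<Rightarrow> real \<Rightarrow> real. \<exists>v :: real \<Rightarrow> real \<Rightarrow> real.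
    (\<forall>A\<in>{0..A0}. \<forall>z0.
       smooth (x A z0) \<and> smooth (y A z0) \<and> smooth (z A z0) \<and>
       abc_solution A B C (x A z0) (y A z0) (z A z0) \<and>
       z A z0 0 = z0 \<and>
       strict_mono (z A z0) \<and>
       ((\<lambda>t. z A z0 t / t) \<longlongrightarrow> v A z0) at_top \<and>
       periodic_in (z A z0) (x A z0) \<and> periodic_in (z A z0) (y A z0) \<and>
       spiral_orbit B C (x A z0) (y A z0) (z A z0) \<and> ballistic (z A z0)) \<and>
    uniform_limit UNIV v (\<lambda>z0. B + C) (at 0 within {0..A0})"
proof -
  obtain A0 K where A0: "A0 > 0" and K: "K > 0" and
    ex: "\<And>A z0. 0 \<le> A \<Longrightarrow> A \<le> A0 \<Longrightarrow> \<exists>x y z v.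
       abc_solution A B C x y z \<and> z 0 = z0 \<and> strict_mono z \<and>
       ((\<lambda>t. z t / t) \<longlongrightarrow> v) at_top \<and> periodic_in z x \<and> periodic_in z y \<and>
       spiral_orbit B C x y z \<and> v > 0 \<and> \<bar>v - (B + C)\<bar> \<le> K * A"
    using ballistic_spiral_family[OF assms] by blast
  \<comment> \<open>The four objects are packed into one tuple so that a single choice for each pair
    of \<open>A\<close> and \<open>z0\<close> yields matching components.\<close>
  define P where "P A z0 = (\<lambda>(x, y, z, v). abc_solution A B C x y z \<and> z 0 = z0 \<and> strict_mono z \<and>
       ((\<lambda>t. z t / t) \<longlongrightarrow> v) at_top \<and> periodic_in z x \<and> periodic_in z y \<and>
       spiral_orbit B C x y z \<and> v > 0 \<and> \<bar>v - (B + C)\<bar> \<le> K * A)" for A z0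
  define f where "f A z0 = (SOME q. P A z0 q)" for A z0
  define x y z v where "x A z0 = fst (f A z0)" and "y A z0 = fst (snd (f A z0))"
    and "z A z0 = fst (snd (snd (f A z0)))" and "v A z0 = snd (snd (snd (f A z0)))" for A z0
  have sol: "abc_solution A B C (x A z0) (y A z0) (z A z0) \<and> z A z0 0 = z0 \<and> strict_mono (z A z0) \<and>
       ((\<lambda>t. z A z0 t / t) \<longlongrightarrow> v A z0) at_top \<and> periodic_in (z A z0) (x A z0) \<and>
       periodic_in (z A z0) (y A z0) \<and> spiral_orbit B C (x A z0) (y A z0) (z A z0) \<and>
       v A z0 > 0 \<and> \<bar>v A z0 - (B + C)\<bar> \<le> K * A" if A: "0 \<le> A" "A \<le> A0" for A z0
  proof -
    have "\<exists>q. P A z0 q" using ex[OF A, of z0] unfolding P_def by fast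
    then have "P A z0 (f A z0)" unfolding f_def by (rule someI_ex)
    then show ?thesis by (simp add: P_def x_def y_def z_def v_def split_beta)
  qed
  \<comment> \<open>The estimate \<open>K * A\<close> does not involve \<open>z0\<close>, so the
    convergence is uniform in it, whichever solutions were chosen.\<close>
  have unif: "uniform_limit UNIV v (\<lambda>z0. B + C) (at 0 within {0..A0})"
  proof (rule uniform_limitI)
    fix e :: real assume e: "e > 0"
    have "dist (v A z0) (B + C) < e" if "A \<in> {0..A0}" "dist A 0 < e / K" for A z0
    proof -
      have "K * A < e" using that K by (simp add: less_divide_eq mult.commute)
      then show ?thesis using sol[of A z0] that by (auto simp: dist_real_def)
    qed
    then show "\<forall>\<^sub>F A in at 0 within {0..A0}. \<forall>z0\<in>UNIV. dist (v A z0) (B + C) < e"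
      unfolding eventually_at using e K by (intro exI[of _ "e / K"]) auto
  qed
  have smooth_ballistic: "smooth (x A z0) \<and> smooth (y A z0) \<and> smooth (z A z0) \<and> ballistic (z A z0)"
    if "A \<in> {0..A0}" for A z0
    using sol[of A z0] abc_solution_smooth[of A B C "x A z0" "y A z0" "z A z0"] that
    by (auto simp: ballistic_def)
  show ?thesis
    by (rule exI[of _ A0], rule conjI[OF A0], rule exI[of _ x], rule exI[of _ y],
        rule exI[of _ z], rule exI[of _ v])
      (use sol smooth_ballistic unif in auto)
qed

end
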